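(* Let $G$ be a permutation group with a cyclic regular normal subgroup $W=\langle w\rangle$ and a cyclic point stabilizer $A=\langle a\rangle$, and let $\alpha$ be an integer with $w^a=w^\alpha$. Let $H=\langle bx,y\rangle$ be a subgroup of $G$ in the normal form, and let $\beta$ be an integer with $w^b=w^\beta$. Put $\overline W=W/(H\cap W)$ and let $l=\operatorname{ord}_{|\overline V|}(\beta)$. Then $H$ is relatively closed in $G$ if and only if the following hold: (1) $a^{\operatorname{ord}_{|\overline W|}(\alpha)}\in\langle b\rangle$; (2) $H\cap W$ contains (a) $x^{\frac{(\beta+1)l}{(2,l)}}$, provided $4$ divides $|\overline W|$ and $\beta\equiv-1\pmod 4$, or (b) $x^{l}$, otherwise.
   Context: All groups are finite. $G=A\ltimes W$ is regarded as a permutation group on the set $W$ via $u^{cv}=u^cv$ for $u,v\in W$, $c\in A$ (where $u^c=c^{-1}uc$; $A$ acts faithfully on $W$ by automorphisms). The relative closure of $H$ in $G$ is the largest subgroup $K\leqslant G$ having the same orbits on $W$ as $H$; $H$ is relatively closed in $G$ if it coincides with its relative closure. For a nonzero integer $m$ and a prime $r$, $m_r$ is the largest power of $r$ dividing $m$; $\pi(g)$ is the set of primes dividing the order $|g|$ of a group element $g$; $(m,k)$ is the greatest common divisor; $\operatorname{ord}_m(k)$ is the multiplicative order of $k$ modulo $m$ for coprime $m,k$ (so $\operatorname{ord}_1(k)=1$). $[b,W]$ is the subgroup generated by the commutators $[b,u]$, $u\in W$. Normal form: $H=\langle bx,y\rangle$ is in the normal form if $b\in A$, $x,y\in W$, $\langle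 y\rangle=H\cap W$, and $|x|_r>\max\{|y|_r,|[b,W]|_r\}$ for every $r\in\pi(x)$. $V$ denotes the largest subgroup of $W$ with $[b,V]=V$ (equivalently, the Hall subgroup of $W$ for the set of primes not dividing $\beta-1$), and $\overline V$ is its image in $\overline W=W/(H\cap W)$; thus $l$ is the order of the automorphism of $\overline V$ induced by $b$. *)

theory Defs
  imports "HOL-Algebra.Algebra" "HOL-Number_Theory.Number_Theory"
begin

text \<open>
  A permutation group on \<^term>\<open>\<Omega>\<close> is rendered as a \<^locale>\<open>faithful_action\<close> \<^term>\<open>\<phi>\<close> of a group
  \<^term>\<open>G\<close> on \<^term>\<open>\<Omega>\<close>. The library's actions are left actions, whereas permutation groups are
  often taken to act on the right. A right action \<open>p\<^sup>g\<close> of \<^term>\<open>G\<close> gives rise to the left action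
  that maps \<open>p\<close> to its image under the inverse of \<open>g\<close>; this changes neither the group
  \<^term>\<open>G\<close> nor the orbits and point stabilizers of its subgroups, so that all identities between elements of \<^term>\<open>G\<close> keep
  their usual form, e.g. the conjugate of \<open>u\<close> by \<open>c\<close> is \<open>c\<^sup>-\<^sup>1 u c\<close>.

  If \<^term>\<open>W\<close> is a regular normal subgroup and \<^term>\<open>A\<close> is the stabilizer of a point \<open>\<omega>\<close>, then
  \<open>u \<mapsto> \<omega>\<^sup>u\<close> identifies \<^term>\<open>W\<close> with \<^term>\<open>\<Omega>\<close>, and the action becomes \<open>u\<^sup>c\<^sup>v = (c\<^sup>-\<^sup>1 u c) v\<close>
  for \<open>c\<close> in \<^term>\<open>A\<close> and \<open>u\<close>, \<open>v\<close> in \<^term>\<open>W\<close>.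
\<close>

definition regular_subgroup ::
  "('g, 'm) monoid_scheme \<Rightarrow> 'p set \<Rightarrow> ('g \<Rightarrow> 'p \<Rightarrow> 'p) \<Rightarrow> 'g set \<Rightarrow> bool" where
  "regular_subgroup G \<Omega> \<phi> W \<longleftrightarrow>
     subgroup W G \<and> (\<forall>p\<in>\<Omega>. \<forall>q\<in>\<Omega>. \<exists>!g. g \<in> W \<and> \<phi> g p = q)"

text \<open>
  Here and in \<open>largest_perfect\<close> below, \<^const>\<open>Greatest\<close> refers to the inclusion order. The
  greatest element exists: it is the set of all elements of \<^term>\<open>G\<close> that map every
  \<^term>\<open>H\<close>-orbit to itself.
\<close>

definition relative_closure ::
  "('g, 'm) monoid_scheme \<Rightarrow> 'p set \<Rightarrow> ('g \<Rightarrow> 'p \<Rightarrow> 'p) \<Rightarrow> 'g set \<Rightarrow> 'g set" where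
  "relative_closure G \<Omega> \<phi> H =
     (GREATEST K. subgroup K G \<and>
        orbits (G\<lparr>carrier := K\<rparr>) \<Omega> \<phi> = orbits (G\<lparr>carrier := H\<rparr>) \<Omega> \<phi>)"

definition relatively_closed ::
  "('g, 'm) monoid_scheme \<Rightarrow> 'p set \<Rightarrow> ('g \<Rightarrow> 'p \<Rightarrow> 'p) \<Rightarrow> 'g set \<Rightarrow> bool" where
  "relatively_closed G \<Omega> \<phi> H \<longleftrightarrow> relative_closure G \<Omega> \<phi> H = H"

definition commutator_with :: "('g, 'm) monoid_scheme \<Rightarrow> 'g \<Rightarrow> 'g set \<Rightarrow> 'g set" where
  "commutator_with G b U =
     generate G {inv\<^bsub>G\<^esub> b \<otimes>\<^bsub>G\<^esub> inv\<^bsub>G\<^esub> u \<otimes>\<^bsub>G\<^esub> b \<otimes>\<^bsub>G\<^esub> u | u. u \<in> U}"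

text \<open>
  The greatest element exists whenever \<^term>\<open>W\<close> is an abelian normal subgroup, being generated
  by all subgroups \<open>V\<close> of \<^term>\<open>W\<close> with \<open>[b, V] = V\<close>.
\<close>

definition largest_perfect :: "('g, 'm) monoid_scheme \<Rightarrow> 'g \<Rightarrow> 'g set \<Rightarrow> 'g set" where
  "largest_perfect G b W =
     (GREATEST V. subgroup V G \<and> V \<subseteq> W \<and> commutator_with G b V = V)"

text \<open>The largest power of \<open>r\<close> dividing \<open>m\<close>, as a number and not as an exponent.\<close>

definition prime_part :: "nat \<Rightarrow> nat \<Rightarrow> nat" where
  "prime_part r m = r ^ multiplicity r m"

definition normal_form ::
  "('g, 'm) monoid_scheme \<Rightarrow> 'g set \<Rightarrow> 'g set \<Rightarrow> 'g set \<Rightarrow> 'g \<Rightarrow> 'g \<Rightarrow> 'g \<Rightarrow> bool" where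
  "normal_form G A W H b x y \<longleftrightarrow>
     H = generate G {b \<otimes>\<^bsub>G\<^esub> x, y} \<and>
     b \<in> A \<and> x \<in> W \<and> y \<in> W \<and>
     generate G {y} = H \<inter> W \<and>
     (\<forall>r \<in> prime_factors (group.ord G x).
        prime_part r (group.ord G x) >
          max (prime_part r (group.ord G y)) (prime_part r (card (commutator_with G b W))))"

end

theory Submission
  imports Defs
begin

text \<open>
  Identify \<open>\<Omega>\<close> with the integers modulo \<open>n = |W|\<close>, so that \<open>a\<^sup>i w\<^sup>j\<close> acts as \<open>u \<mapsto> \<alpha>\<^sup>i u + j\<close>.
  With \<open>x = w\<^sup>\<xi>\<close> and \<open>m = |W/(H \<inter> W)|\<close>, the orbits of \<open>H\<close> are the preimages of the orbits of
  \<open>f: u \<mapsto> \<beta>u + \<xi>\<close> modulo \<open>m\<close>. As the relative closure of \<open>H\<close> consists of the elements of \<open>G\<close>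
  that preserve every \<open>H\<close>-orbit, everything becomes arithmetic of the iterates of \<open>f\<close>, whose
  translation parts are \<open>\<xi>(1 + \<beta> + \<dots> + \<beta>\<^bsup>k-1\<^esup>)\<close>.

  Condition (1) puts the kernel of the action modulo \<open>m\<close> into \<open>H\<close>. If (2) fails at a prime \<open>r\<close>, then \<open>r\<close>
  divides \<open>\<beta> - 1\<close>, and the orbits of the iterates of \<open>f\<close> that are trivial away from \<open>r\<close> are preserved by
  a nontrivial translation of the \<open>r\<close>-part, which belongs to the closure but not to \<open>H\<close>. If (2) holds,
  then iterates with equal action on \<open>V\<close> (and exponents of equal parity in case (a)) have equal
  translation parts. For an orbit-preserving affine map, comparing the iterates of \<open>f\<close> that it agrees with
  at \<open>1\<close> and at a point that is \<open>1\<close> in \<open>V\<close> and \<open>0\<close> in the complement then shows that it is an iterate of \<open>f\<close>.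
\<close>

section \<open>Prime powers and geometric sums\<close>

lemma prime_power_split:
  fixes d :: nat
  assumes "Factorial_Ring.prime r" "d > 0"
  obtains e d' where "d = r ^ e * d'" "\<not> r dvd d'"
proof -
  have "\<not> is_unit r" using prime_gt_1_nat[OF assms(1)] by simp
  then have "\<not> r dvd d div r ^ multiplicity r d" using assms(2) by (intro multiplicity_decompose) auto
  then show ?thesis
    by (intro that[of "multiplicity r d" "d div r ^ multiplicity r d"]) (simp_all add: multiplicity_dvd)
qed

text \<open>Local-global principle, by comparing multiplicities. Writing
  \<open>m = r ^ e * m'\<close> names the full \<open>r\<close>-part of \<open>m\<close>; the case
  \<open>e = 0\<close> is included.\<close>

lemma dvd_of_prime_powers_dvd:
  fixes m :: nat and Q :: int
  assumes "m > 0"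
    and "\<And>r e m'. \<lbrakk>Factorial_Ring.prime r; m = r ^ e * m'; \<not> r dvd m'\<rbrakk> \<Longrightarrow> int r ^ e dvd Q"
  shows "int m dvd Q"
proof (cases "Q = 0")
  case False
  have "m dvd nat \<bar>Q\<bar>"
  proof (rule multiplicity_le_imp_dvd)
    show "m \<noteq> 0" using assms by simp
    fix p :: nat assume p: "Factorial_Ring.prime p"
    then obtain e m' where m': "m = p ^ e * m'" "\<not> p dvd m'"
      using prime_power_split assms(1) by blast
    have p1: "\<not> is_unit p" using prime_gt_1_nat[OF p] by simp
    have "multiplicity p m = e"
      using m' p1 prime_gt_0_nat[OF p] by (intro multiplicity_eqI) auto
    moreover have "p ^ e dvd nat \<bar>Q\<bar>"
      using assms(2)[OF p m'] by (simp add: dvd_nat_abs_iff)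
    ultimately show "multiplicity p m \<le> multiplicity p (nat \<bar>Q\<bar>)"
      using False p1 by (intro multiplicity_geI) auto
  qed
  then show ?thesis by (simp add: dvd_nat_abs_iff)
qed simp

section \<open>Geometric sums modulo prime powers\<close>

text \<open>This is the value at 0 of the \<open>k\<close>-th iterate of
  \<open>u \<mapsto> g * u + 1\<close>. It is a sum rather than a quotient by \<open>g - 1\<close>,
  because the relevant primes are those dividing \<open>g - 1\<close>.\<close>

definition geom :: "int \<Rightarrow> nat \<Rightarrow> int" where
  "geom g k = (\<Sum>t<k. g ^ t)"

lemma geom_0 [simp]: "geom g 0 = 0"
  and geom_Suc: "geom g (Suc k) = geom g k + g ^ k"
  by (simp_all add: geom_def)

lemma geom_add: "geom g (i + j) = geom g i + g ^ i * geom g j"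
  by (induction j) (simp_all add: geom_Suc algebra_simps power_add)

text \<open>The \<open>i * j\<close> terms are cut into \<open>j\<close> blocks of length
  \<open>i\<close>; the block with index \<open>t\<close> is \<open>g ^ (i * t)\<close> times the
  first one.\<close>

lemma geom_mult: "geom g (i * j) = geom g i * geom (g ^ i) j"
proof (induction j)
  case (Suc j)
  have "geom g (i * Suc j) = geom g (i * j + i)" by (simp add: add.commute)
  also have "\<dots> = geom g i * geom (g ^ i) j + g ^ (i * j) * geom g i"
    by (simp only: geom_add Suc)
  also have "\<dots> = geom g i * geom (g ^ i) (Suc j)"
    by (simp add: geom_Suc power_mult algebra_simps)
  finally show ?case .
qed simp

lemma power_minus_one: "g ^ k - 1 = (g - 1) * geom g k"
proof (induction k)
  case (Suc k)
  have "g ^ Suc k - 1 = (g - 1) * g ^ k + (g ^ k - 1)" by (simp add: algebra_simps)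
  then show ?case by (simp add: Suc geom_Suc distrib_left)
qed simp

lemma geom_cong: "[g = h] (mod m) \<Longrightarrow> [geom g k = geom h k] (mod m)"
  unfolding geom_def by (intro cong_sum cong_pow)

lemma geom_one [simp]: "geom 1 k = int k"
  by (simp add: geom_def)

lemma geom_cong_int: "m dvd g - 1 \<Longrightarrow> [geom g k = int k] (mod m)"
  using geom_cong[of g 1 m k] by (simp add: cong_iff_dvd_diff)

text \<open>The easy half of lifting the exponent, valid for \<open>r = 2\<close> as well: by
  \<open>geom_mult\<close> every factor \<open>r\<close> of \<open>d\<close> contributes a sum of
  length \<open>r\<close>, which is congruent to \<open>r\<close>, and \<open>g ^ r\<close> is again
  1 modulo \<open>r\<close>.\<close>

lemma power_dvd_geom:
  assumes "int r dvd g - 1" "r ^ k dvd d"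
  shows "int r ^ k dvd geom g d"
proof -
  have "int r ^ k dvd geom g (r ^ k * d')" for d'
    using assms(1)
  proof (induction k arbitrary: g)
    case (Suc k)
    have "int r dvd geom g r"
      using geom_cong_int[OF Suc.prems, of r] by (simp add: cong_dvd_iff)
    moreover have "int r ^ k dvd geom (g ^ r) (r ^ k * d')"
      using Suc.prems by (intro Suc.IH) (simp add: power_minus_one)
    ultimately have "int r * int r ^ k dvd geom g r * geom (g ^ r) (r ^ k * d')"
      by (rule mult_dvd_mono)
    then show ?case by (simp add: geom_mult[symmetric] mult.assoc)
  qed simp
  with assms(2) show ?thesis by (auto elim: dvdE)
qed

text \<open>The \<open>r\<close>-part of \<open>d\<close> divides \<open>geom g d\<close>, so
  \<open>d\<close> may be replaced by \<open>geom g d\<close> in a divisibility by a power of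
  \<open>r\<close>.\<close>

lemma power_dvd_mult_geom:
  assumes r: "Factorial_Ring.prime r" "int r dvd g - 1" and "int r ^ e dvd c * int d"
  shows "int r ^ e dvd c * geom g d"
proof (cases "d = 0")
  case False
  then obtain k d' where d': "d = r ^ k * d'" "\<not> r dvd d'"
    using prime_power_split[OF r(1), of d] by auto
  have "coprime (int r ^ e) (int d')"
    using d' r by (simp add: prime_imp_coprime)
  moreover have "int r ^ e dvd (c * int r ^ k) * int d'"
    using assms(3) arg_cong[OF d'(1), of int] by (simp add: mult.assoc)
  ultimately have "int r ^ e dvd c * int r ^ k" by (simp add: coprime_dvd_mult_left_iff)
  also have "\<dots> dvd c * geom g d"
    by (intro mult_dvd_mono power_dvd_geom r(2)) (simp_all add: d'(1))
  finally show ?thesis .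
qed simp

text \<open>For \<open>r = 2\<close> the sum is \<open>1 + g\<close>, which is 2 modulo 4. For odd
  \<open>r\<close> the powers of \<open>g\<close> are expanded to first order modulo
  \<open>r ^ 2\<close>, and the linear terms add up to 0.\<close>

lemma geom_prime:
  assumes r: "Factorial_Ring.prime r" "int r dvd g - 1" "r = 2 \<Longrightarrow> 4 dvd g - 1"
  obtains s where "geom g r = int r * s" "\<not> int r dvd s"
proof (cases "r = 2")
  case True
  then obtain z where "g = 1 + 4 * z" using r(3) by (auto elim!: dvdE simp: algebra_simps)
  then have "geom g r = int r * (1 + 2 * z)" "\<not> int r dvd 1 + 2 * z"
    using True by (simp_all add: geom_def numeral_2_eq_2)
  then show ?thesis by (rule that)
next
  case False
  with r have "odd r" using prime_odd_nat prime_ge_2_nat[OF r(1)] by (simp add: order_le_less)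
  then obtain q where q: "r = 2 * q + 1" by (elim oddE)
  obtain z where z: "g - 1 = int r * z" using r(2) by (elim dvdE)
  \<comment> \<open>The binomial expansion of \<open>g ^ t\<close> around 1, truncated after the
    linear term.\<close>
  have *: "int r ^ 2 dvd g ^ t - (1 + int t * (g - 1))" for t
  proof -
    have "g ^ t - (1 + int t * (g - 1)) = (g - 1) * (geom g t - int t)"
      using power_minus_one[of g t] by (simp add: algebra_simps)
    moreover have "int r dvd geom g t - int t"
      using geom_cong_int[OF r(2)] by (simp add: cong_iff_dvd_diff)
    ultimately show ?thesis using r(2) by (simp add: power2_eq_square mult_dvd_mono)
  qed
  have tri: "2 * (\<Sum>t<k. int t) = int k * (int k - 1)" for k
    by (induction k) (simp_all add: algebra_simps)
  have "int r ^ 2 dvd (\<Sum>t<r. g ^ t - (1 + int t * (g - 1)))"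
    by (rule dvd_sum) (use * in auto)
  also have "(\<Sum>t<r. g ^ t - (1 + int t * (g - 1))) = geom g r - int r - (\<Sum>t<r. int t) * (g - 1)"
    by (simp add: geom_def sum_subtractf sum.distrib sum_distrib_right)
  finally have 1: "int r ^ 2 dvd geom g r - int r - (\<Sum>t<r. int t) * (g - 1)" .
  \<comment> \<open>Oddness of \<open>r\<close> enters here: \<open>q\<close> is half of
    \<open>r - 1\<close>, so the sum is a multiple of \<open>r\<close> and its product with
    \<open>g - 1\<close> vanishes modulo \<open>r ^ 2\<close>.\<close>
  have "(\<Sum>t<r. int t) = int r * int q"
    using tri[of r] q by simp
  then have "int r ^ 2 dvd (\<Sum>t<r. int t) * (g - 1)"
    by (simp add: z power2_eq_square)
  with 1 have "int r ^ 2 dvd geom g r - int r" by (simp add: dvd_diff_left_iff)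
  then obtain v where "geom g r - int r = int r ^ 2 * v" by (elim dvdE)
  then have eq: "geom g r = int r * (1 + int r * v)" by (simp add: power2_eq_square algebra_simps)
  have "\<not> int r dvd 1 + int r * v"
    using prime_gt_1_nat[OF r(1)] by (simp add: dvd_add_left_iff zdvd1_eq)
  with eq show ?thesis by (rule that)
qed

text \<open>Lifting the exponent: \<open>geom g d\<close> and \<open>d\<close> have the same
  \<open>r\<close>-part. The hypothesis \<open>four\<close> excludes cases such as
  \<open>g = 3\<close> and \<open>d = 2\<close> at the prime 2, where the sum is 4.\<close>

lemma geom_exact:
  assumes r: "Factorial_Ring.prime r" "int r dvd g - 1"
    and four: "r = 2 \<Longrightarrow> 4 dvd g - 1 \<or> odd d"
    and d: "d = r ^ k * d'" "\<not> r dvd d'"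
  obtains s where "geom g d = int r ^ k * s" "\<not> int r dvd s"
proof -
  have "\<exists>s. geom g (r ^ k * d') = int r ^ k * s \<and> \<not> int r dvd s"
    using r(2) four unfolding d(1)
  proof (induction k arbitrary: g)
    case 0
    have "\<not> int r dvd geom g d'"
      using geom_cong_int[OF 0(1), of d'] d(2) by (simp add: cong_dvd_iff)
    then show ?case by simp
  next
    case (Suc k)
    \<comment> \<open>For \<open>r = 2\<close> the length of the sum is now even, which leaves only
      the first alternative of the hypothesis.\<close>
    have 4: "r = 2 \<Longrightarrow> 4 dvd g - 1" using Suc.prems(2) by simp
    obtain s where s: "geom g r = int r * s" "\<not> int r dvd s"
      using geom_prime[OF r(1) Suc.prems(1) 4] by blast
    have "\<exists>s. geom (g ^ r) (r ^ k * d') = int r ^ k * s \<and> \<not> int r dvd s"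
      using Suc.prems 4 by (intro Suc.IH) (simp_all add: power_minus_one)
    then obtain s' where s': "geom (g ^ r) (r ^ k * d') = int r ^ k * s'" "\<not> int r dvd s'" by blast
    have "geom g (r ^ Suc k * d') = int r ^ Suc k * (s * s')"
      using geom_mult[of g r "r ^ k * d'"] s s' by (simp add: ac_simps)
    moreover have "\<not> int r dvd s * s'"
      using s s' r(1) by (simp add: prime_dvd_mult_iff)
    ultimately show ?case by blast
  qed
  then show ?thesis using that d(1) by blast
qed

lemma cong_linear_solvable:
  fixes s :: int
  assumes "Factorial_Ring.prime r" "\<not> int r dvd s"
  shows "\<exists>z. [s * z = c] (mod (int r ^ e))"
proof -
  have "coprime (int r) s" using assms by (simp add: prime_imp_coprime)
  then have "coprime s (int r ^ e)" by (simp add: coprime_commute)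
  then obtain z where "[s * z = 1] (mod (int r ^ e))" using cong_solve_coprime_int by blast
  then have "[c * (s * z) = c * 1] (mod (int r ^ e))" by (rule cong_scalar_left)
  then have "[s * (c * z) = c] (mod (int r ^ e))" by (simp add: ac_simps)
  then show ?thesis by blast
qed

text \<open>Hensel-type lifting: adding \<open>r ^ e * t0\<close> to \<open>t\<close> changes the
  sum, modulo \<open>r ^ Suc e\<close>, by \<open>r ^ e\<close> times a unit times
  \<open>t0\<close>. Hence one digit of the error can be removed at each stage.\<close>

lemma geom_surj:
  assumes r: "Factorial_Ring.prime r" "int r dvd g - 1"
    and "r = 2 \<Longrightarrow> 4 dvd g - 1 \<or> e \<le> 1"
  shows "\<exists>t. [geom g t = c] (mod (int r ^ e))"
  using assms(3)
proof (induction e)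
  case (Suc e)
  then obtain t where t: "[geom g t = c] (mod (int r ^ e))" by auto
  then obtain q where q: "geom g t - c = int r ^ e * q" by (auto simp: cong_iff_dvd_diff elim!: dvdE)
  \<comment> \<open>In the second alternative \<open>Suc e \<le> 1\<close> forces
    \<open>e = 0\<close>, and then \<open>r ^ e = 1\<close> is odd.\<close>
  have "r = 2 \<Longrightarrow> 4 dvd g - 1 \<or> odd (r ^ e)" using Suc.prems by auto
  then obtain s where s: "geom g (r ^ e) = int r ^ e * s" "\<not> int r dvd s"
    using geom_exact[OF r, of "r ^ e" e 1] prime_gt_1_nat[OF r(1)] by auto
  \<comment> \<open>\<open>q\<close> is the current error divided by \<open>r ^ e\<close>, and
    \<open>z\<close> is the digit cancelling it; the factor \<open>g ^ t\<close> may be ignored,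
    being 1 modulo \<open>r\<close>.\<close>
  obtain z where z: "[s * z = - q] (mod (int r))"
    using cong_linear_solvable[OF r(1) s(2), of "- q" 1] by auto
  define t0 where "t0 = nat (z mod int r)"
  have t0: "[int t0 = z] (mod (int r))"
    using prime_gt_0_nat[OF r(1)] by (simp add: t0_def cong_def)
  define h where "h = g ^ (r ^ e)"
  have h: "int r dvd h - 1" using r(2) by (simp add: h_def power_minus_one)
  have "[g ^ t * s * geom h t0 = 1 * s * z] (mod (int r))"
  proof (intro cong_mult cong_refl)
    show "[g ^ t = 1] (mod (int r))" using r(2) by (simp add: cong_iff_dvd_diff power_minus_one)
    show "[geom h t0 = z] (mod (int r))" using geom_cong_int[OF h] t0 by (rule cong_trans)
  qed
  with z have "[g ^ t * s * geom h t0 = - q] (mod (int r))" by (auto intro: cong_trans)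
  then have "int r dvd q + g ^ t * s * geom h t0" by (simp add: cong_iff_dvd_diff add.commute)
  then have "int r ^ Suc e dvd int r ^ e * (q + g ^ t * s * geom h t0)"
    by (simp add: mult.commute mult_dvd_mono)
  also have "int r ^ e * (q + g ^ t * s * geom h t0) = geom g (t + r ^ e * t0) - c"
    using q unfolding geom_add geom_mult s(1) h_def by (simp add: algebra_simps)
  finally show ?case by (auto simp: cong_iff_dvd_diff)
qed simp

text \<open>The unit \<open>s\<close> is inverted and \<open>geom_surj\<close> supplies
  \<open>t\<close>. The common factor \<open>int r ^ v\<close> accommodates displacements that are a
  known power of \<open>r\<close> times a unit.\<close>

lemma geom_solve:
  assumes r: "Factorial_Ring.prime r" "int r dvd g - 1" "r = 2 \<Longrightarrow> 4 dvd g - 1 \<or> e \<le> 1"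
    and "\<not> int r dvd s"
  shows "\<exists>t. [int r ^ v * s * geom g t = int r ^ v * q] (mod (int r ^ e))"
proof -
  obtain z where z: "[s * z = q] (mod (int r ^ e))"
    using cong_linear_solvable assms by blast
  obtain t where "[geom g t = z] (mod (int r ^ e))" using geom_surj[OF r] by blast
  then have "[int r ^ v * s * geom g t = int r ^ v * s * z] (mod (int r ^ e))" by (rule cong_scalar_left)
  moreover have "[int r ^ v * (s * z) = int r ^ v * q] (mod (int r ^ e))" using z by (rule cong_scalar_left)
  ultimately have "[int r ^ v * s * geom g t = int r ^ v * q] (mod (int r ^ e))"
    unfolding mult.assoc by (rule cong_trans)
  then show ?thesis by blast
qed

lemma prime_power_split_int:
  fixes \<xi> :: int
  assumes "Factorial_Ring.prime r" "\<xi> \<noteq> 0"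
  obtains c \<xi>' where "\<xi> = int r ^ c * \<xi>'" "\<not> int r dvd \<xi>'"
proof -
  obtain c d where d: "nat \<bar>\<xi>\<bar> = r ^ c * d" "\<not> r dvd d"
    using prime_power_split[OF assms(1), of "nat \<bar>\<xi>\<bar>"] assms(2) by auto
  have "\<xi> = sgn \<xi> * \<bar>\<xi>\<bar>" by (simp add: sgn_mult_abs)
  also have "\<bar>\<xi>\<bar> = int (r ^ c * d)" using d(1) by linarith
  finally have "\<xi> = int r ^ c * (sgn \<xi> * int d)" by (simp add: ac_simps)
  moreover have "\<not> int r dvd sgn \<xi> * int d"
    using d(2) assms(2) by (cases \<xi> rule: linorder_cases[of 0]) (simp_all add: sgn_if)
  ultimately show ?thesis by (rule that)
qed

section \<open>Multiplicative orders of integers, and the splitting into coprime parts\<close>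

text \<open>Replacing \<open>b\<close> by its least nonnegative residue reduces orders of integers
  to orders of natural numbers.\<close>

lemma ord_int:
  fixes b :: int
  assumes "n > 0"
  shows "ord (int n) b = ord n (nat (b mod int n))"
proof -
  define c where "c = nat (b mod int n)"
  have c: "[int c = b] (mod (int n))" using assms by (simp add: c_def cong_def)
  have "[b ^ d = 1] (mod (int n)) \<longleftrightarrow> [c ^ d = 1] (mod n)" for d
  proof -
    have "[int c ^ d = b ^ d] (mod (int n))" using c by (rule cong_pow)
    then have "[b ^ d = 1] (mod (int n)) \<longleftrightarrow> [int c ^ d = 1] (mod (int n))"
      by (metis cong_sym cong_trans)
    also have "\<dots> \<longleftrightarrow> [int (c ^ d) = int 1] (mod (int n))" by simp
    finally show ?thesis by (simp only: cong_int_iff)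
  qed
  moreover have "coprime (int n) b \<longleftrightarrow> coprime n c"
    using cong_imp_coprime[OF c] cong_imp_coprime[OF cong_sym[OF c]]
    by (auto simp: coprime_commute simp flip: coprime_int_iff)
  ultimately show ?thesis unfolding ord_def c_def[symmetric] by simp
qed

lemma ord_int_dvd_iff:
  fixes b :: int
  assumes "n > 0"
  shows "ord (int n) b dvd d \<longleftrightarrow> [b ^ d = 1] (mod (int n))"
proof -
  define c where "c = nat (b mod int n)"
  have c: "[int c = b] (mod (int n))" using assms by (simp add: c_def cong_def)
  then have "[int c ^ d = b ^ d] (mod (int n))" by (rule cong_pow)
  then have "[b ^ d = 1] (mod (int n)) \<longleftrightarrow> [int (c ^ d) = int 1] (mod (int n))"
    by (metis cong_sym cong_trans of_nat_power of_nat_1)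
  also have "\<dots> \<longleftrightarrow> ord n c dvd d" by (simp only: cong_int_iff ord_divides)
  finally show ?thesis using ord_int[OF assms] by (simp add: c_def)
qed

lemma ord_int_pos:
  fixes b :: int
  assumes "n > 0" "coprime (int n) b"
  shows "ord (int n) b > 0"
proof -
  define c where "c = nat (b mod int n)"
  have c: "[int c = b] (mod (int n))" using assms by (simp add: c_def cong_def)
  have "coprime n c"
    using cong_imp_coprime[OF cong_sym[OF c]] assms(2)
    by (auto simp: coprime_commute simp flip: coprime_int_iff)
  then show ?thesis using ord_int[OF assms(1)] by (simp add: c_def)
qed

text \<open>Applied to \<open>n\<close> and \<open>\<beta> - 1\<close>, this separates the Hall
  subgroup \<open>V\<close> of \<open>W\<close> from its complement. The induction moves the full
  power of one common prime into \<open>N2\<close> at a time.\<close>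

lemma coprime_split:
  fixes N :: nat and z :: int
  assumes "N > 0"
  obtains N1 N2 where "N = N1 * N2" "coprime N1 N2" "coprime (int N1) z"
    "\<And>r. \<lbrakk>Factorial_Ring.prime r; r dvd N2\<rbrakk> \<Longrightarrow> int r dvd z"
proof -
  have "\<exists>N1 N2. N = N1 * N2 \<and> coprime N1 N2 \<and> coprime (int N1) z \<and>
      (\<forall>r. Factorial_Ring.prime r \<longrightarrow> r dvd N2 \<longrightarrow> int r dvd z)"
    using assms
  proof (induction N rule: less_induct)
    case (less N)
    show ?case
    proof (cases "coprime (int N) z")
      case True
      then show ?thesis by (intro exI[of _ N] exI[of _ 1]) (auto simp: prime_nat_iff)
    next
      case False
      then have "gcd N (nat \<bar>z\<bar>) \<noteq> 1"
        by (metis coprime_iff_gcd_eq_1 gcd_int_def nat_int of_nat_1 abs_of_nat)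
      then obtain p where p: "Factorial_Ring.prime p" "p dvd gcd N (nat \<bar>z\<bar>)"
        using prime_factor_nat by blast
      have pN: "p dvd N" using p(2) gcd_dvd1 by (rule dvd_trans)
      have "p dvd nat \<bar>z\<bar>" using p(2) gcd_dvd2 by (rule dvd_trans)
      then have pz: "int p dvd z" by (simp only: dvd_nat_abs_iff)
      obtain e N' where N': "N = p ^ e * N'" "\<not> p dvd N'" using prime_power_split[OF p(1)] less.prems by blast
      have e: "e \<noteq> 0" using N' pN by (metis mult_1 power_0)
      have "p ^ e > 1" using one_less_power[OF prime_gt_1_nat[OF p(1)]] e by blast
      then have "N' < N" "N' > 0" using less.prems N'(1) by (auto intro: Nat.gr0I)
      from less.IH[OF this] obtain N1 N2 where
        IH: "N' = N1 * N2" "coprime N1 N2" "coprime (int N1) z"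
          "\<forall>r. Factorial_Ring.prime r \<longrightarrow> r dvd N2 \<longrightarrow> int r dvd z" by blast
      have "\<not> p dvd N1" using N'(2) IH(1) by auto
      then have "coprime (p ^ e) N1" using p(1) by (simp add: prime_imp_coprime)
      then have "coprime N1 (p ^ e)" by (simp only: coprime_commute)
      then have "coprime N1 (p ^ e * N2)" using IH(2) by simp
      moreover have "int r dvd z" if r: "Factorial_Ring.prime r" "r dvd p ^ e * N2" for r
      proof -
        have "r dvd p \<or> r dvd N2" using r prime_dvd_mult_iff prime_dvd_power by metis
        then show ?thesis using IH(4) r(1) pz p(1) primes_dvd_imp_eq by metis
      qed
      ultimately show ?thesis using N'(1) IH by (intro exI[of _ N1] exI[of _ "p ^ e * N2"]) auto
    qed
  qed
  then show ?thesis using that by blast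
qed

section \<open>Iterates of an affine map modulo m\<close>

text \<open>The arithmetic data of \<open>H\<close>: \<open>nV\<close> and \<open>mU\<close> are the
  orders of the image of \<open>V\<close> and of its complement in the quotient of order
  \<open>m\<close>. Assumption \<open>nf\<close> is the normal form in terms of exponents: at each
  prime where \<open>\<xi>\<close> does not vanish modulo \<open>m\<close>,
  \<open>\<beta> - 1\<close> contains a strictly higher power than \<open>\<xi>\<close>.\<close>

locale affine_map =
  fixes m nV mU l :: nat and \<beta> \<xi> :: int
  assumes m_pos: "m > 0" and m_eq: "m = nV * mU"
    and coprime_parts: "coprime nV mU"
    and coprime_nV: "coprime (int nV) (\<beta> - 1)"
    and prime_mU: "\<And>r. \<lbrakk>Factorial_Ring.prime r; r dvd mU\<rbrakk> \<Longrightarrow> int r dvd \<beta> - 1"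
    and coprime_beta: "coprime (int m) \<beta>"
    and l_def: "l = ord (int nV) \<beta>"
    and nf: "\<And>r e c. \<lbrakk>Factorial_Ring.prime r; r ^ e dvd m; \<not> int r ^ e dvd \<xi>; int r ^ c dvd \<xi>\<rbrakk>
      \<Longrightarrow> int r ^ Suc c dvd \<beta> - 1"
begin

definition iterate :: "nat \<Rightarrow> int \<Rightarrow> int" where
  "iterate k u = \<beta> ^ k * u + \<xi> * geom \<beta> k"

definition exceptional :: bool where
  "exceptional \<longleftrightarrow> 4 dvd m \<and> [\<beta> = -1] (mod 4)"

text \<open>Condition (2) of the theorem, using that the power of \<open>x\<close> with exponent
  \<open>z\<close> lies in the intersection of \<open>H\<close> and \<open>W\<close> exactly when
  \<open>m\<close> divides \<open>\<xi> * z\<close>. The integer division is exact, since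
  \<open>gcd 2 l\<close> divides \<open>l\<close>.\<close>

definition translation_part_trivial :: bool where
  "translation_part_trivial \<longleftrightarrow>
    (if exceptional then int m dvd \<xi> * ((\<beta> + 1) * int l div int (gcd 2 l)) else int m dvd \<xi> * int l)"

text \<open>The displacement after \<open>k\<close> steps is a geometric sum times the displacement
  after one step, so its power of \<open>r\<close> can be read off from the two factors.\<close>

lemma iterate_diff: "iterate k u - u = geom \<beta> k * ((\<beta> - 1) * u + \<xi>)"
proof -
  have "iterate k u - u = (\<beta> ^ k - 1) * u + \<xi> * geom \<beta> k" by (simp add: iterate_def algebra_simps)
  then show ?thesis by (simp only: power_minus_one) (simp add: algebra_simps)
qed

lemma coprime_nV_beta: "coprime (int nV) \<beta>"
  using coprime_beta by (simp add: m_eq)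

lemma nV_pos: "nV > 0"
  using m_pos by (simp add: m_eq)

lemma l_dvd_iff: "l dvd N \<longleftrightarrow> [\<beta> ^ N = 1] (mod (int nV))"
  unfolding l_def using nV_pos by (rule ord_int_dvd_iff)

lemma l_pos: "l > 0"
  unfolding l_def using nV_pos coprime_nV_beta by (rule ord_int_pos)

text \<open>Where \<open>\<xi>\<close> is nontrivial, \<open>nf\<close> with \<open>c = 0\<close>
  makes the prime divide \<open>\<beta> - 1\<close>, which is coprime to \<open>nV\<close>. Hence
  the map is linear on the \<open>V\<close>-part.\<close>

lemma nV_dvd_xi: "int nV dvd \<xi>"
proof (rule dvd_of_prime_powers_dvd)
  show "nV > 0" by (rule nV_pos)
  fix r e m' assume r: "Factorial_Ring.prime r" "nV = r ^ e * m'"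
  show "int r ^ e dvd \<xi>"
  proof (rule ccontr)
    assume xi: "\<not> int r ^ e dvd \<xi>"
    then have "e \<noteq> 0" by (metis one_dvd power_0)
    then have "int r dvd int nV" using r(2) by (auto intro: dvd_mult2)
    moreover have "int r dvd \<beta> - 1" using nf[OF r(1) _ xi, of 0] by (simp add: m_eq r(2))
    ultimately have "is_unit (int r)" using coprime_nV coprime_common_divisor by blast
    then show False using prime_gt_1_nat[OF r(1)] by simp
  qed
qed

lemma nV_dvd_power: "l dvd N \<Longrightarrow> int nV dvd \<beta> ^ N - 1"
  by (simp add: l_dvd_iff cong_iff_dvd_diff)

text \<open>The strict gap between the two powers of \<open>r\<close> makes
  \<open>(\<beta> - 1) * u + \<xi>\<close> equal to \<open>r ^ c\<close> times a unit at
  \<open>r\<close>, for every \<open>u\<close>.\<close>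

lemma xi_decomposition:
  assumes r: "Factorial_Ring.prime r" "r ^ e dvd m" "\<not> int r ^ e dvd \<xi>"
  obtains c \<xi>' B where "\<xi> = int r ^ c * \<xi>'" "\<not> int r dvd \<xi>'" "\<beta> - 1 = int r ^ Suc c * B"
proof -
  have "\<xi> \<noteq> 0" using r(3) by auto
  then obtain c \<xi>' where xi: "\<xi> = int r ^ c * \<xi>'" "\<not> int r dvd \<xi>'"
    using prime_power_split_int r(1) by blast
  then have "int r ^ Suc c dvd \<beta> - 1" by (intro nf[OF r]) simp
  with xi show ?thesis using that by (auto elim: dvdE)
qed

lemma dvd_beta_minus_one:
  assumes "Factorial_Ring.prime r" "r ^ e dvd m" "\<not> int r ^ e dvd \<xi>"
  shows "int r dvd \<beta> - 1"
  using nf[OF assms, of 0] by simp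

lemma exceptional_4_dvd: "exceptional \<Longrightarrow> 4 dvd int m"
  using of_nat_dvd_iff[of 4 m, where 'a = int] by (simp add: exceptional_def)

text \<open>Here \<open>\<beta> - 1\<close> is 2 modulo 4, so the strict gap required by
  \<open>nf\<close> leaves no factor 2 for \<open>\<xi>\<close>.\<close>

lemma exceptional_odd_xi:
  assumes "exceptional" "2 ^ e dvd m" "\<not> 2 ^ e dvd \<xi>"
  shows "odd \<xi>"
proof
  assume "even \<xi>"
  then have "4 dvd \<beta> - 1" using nf[of 2 e 1] assms by simp
  moreover have "4 dvd \<beta> + 1" using assms by (simp add: exceptional_def cong_iff_dvd_diff)
  ultimately show False by presburger
qed

lemma exceptional_exponent:
  "int l div int (gcd 2 l) * int (gcd 2 l) = int l"
  "(\<beta> + 1) * int l div int (gcd 2 l) = (\<beta> + 1) * int (l div gcd 2 l)"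
  by (simp_all add: dvd_div_mult_self div_mult_swap[symmetric] zdiv_int)

section \<open>Vanishing of translation parts under condition (2)\<close>

text \<open>At most primes \<open>\<xi> * l\<close> already vanishes, and
  \<open>power_dvd_mult_geom\<close> passes from \<open>d\<close> to \<open>geom \<beta> d\<close>.
  At 2 in the exceptional case consecutive terms are paired, which produces
  \<open>\<beta> + 1\<close> and a sum in powers of \<open>\<beta> ^ 2\<close>; this needs
  \<open>d\<close> to be even.\<close>

lemma dvd_xi_geom:
  assumes triv: "translation_part_trivial" and "l dvd d"
    and parity: "exceptional \<Longrightarrow> even (\<xi> * int d)"
  shows "int m dvd \<xi> * geom \<beta> d"
proof (rule dvd_of_prime_powers_dvd[OF m_pos])
  fix r e m' assume r: "Factorial_Ring.prime r" and m: "m = r ^ e * m'" and "\<not> r dvd m'"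
  have rm: "r ^ e dvd m" by (simp add: m)
  then have rm': "int r ^ e dvd int m" by (metis of_nat_dvd_iff of_nat_power)
  show "int r ^ e dvd \<xi> * geom \<beta> d"
  proof (cases "int r ^ e dvd \<xi>")
    case False
    note r1 = dvd_beta_minus_one[OF r rm False]
    show ?thesis
    proof (cases "exceptional \<and> r = 2")
      case True
      have xi: "odd \<xi>" using exceptional_odd_xi[of e] True rm False by simp
      with parity True obtain d' where d: "d = 2 * d'" by auto
      define l' where "l' = l div gcd 2 l"
      have "l' dvd d'"
      proof (cases "even l")
        case True
        with \<open>l dvd d\<close> d show ?thesis by (auto simp: l'_def gcd_nat.absorb1 elim!: evenE)
      next
        case False
        then have "coprime 2 l" by simp
        then have "gcd 2 l = 1" by (simp only: coprime_iff_gcd_eq_1)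
        then show ?thesis using False \<open>l dvd d\<close> \<open>coprime 2 l\<close> d
          by (simp add: l'_def coprime_dvd_mult_right_iff coprime_commute)
      qed
      then have "int l' dvd int d'" by simp
      have "int r ^ e dvd \<xi> * ((\<beta> + 1) * int l')"
        using triv True rm' by (auto simp: translation_part_trivial_def exceptional_exponent l'_def intro: dvd_trans)
      also have "\<dots> dvd \<xi> * (\<beta> + 1) * int d'"
        using \<open>int l' dvd int d'\<close> by (simp add: mult.assoc mult_dvd_mono)
      finally have "int r ^ e dvd \<xi> * (\<beta> + 1) * geom (\<beta> ^ 2) d'"
        using r r1 by (intro power_dvd_mult_geom) (auto simp: power_minus_one)
      also have "\<xi> * (\<beta> + 1) * geom (\<beta> ^ 2) d' = \<xi> * geom \<beta> d"
        unfolding d geom_mult by (simp add: geom_def numeral_2_eq_2 ac_simps)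
      finally show ?thesis .
    next
      case ne: False
      have "int r ^ e dvd \<xi> * int l"
      proof (cases exceptional)
        case True
        \<comment> \<open>At an odd prime case (a) is no different from case (b): multiplying by
          \<open>gcd 2 l\<close> restores \<open>l\<close>, and \<open>\<beta> + 1\<close> is a unit
          since \<open>r\<close> divides \<open>\<beta> - 1\<close>.\<close>
        then have "int r ^ e dvd \<xi> * ((\<beta> + 1) * int (l div gcd 2 l))"
          using triv rm' by (auto simp: translation_part_trivial_def exceptional_exponent intro: dvd_trans)
        then have "int r ^ e dvd \<xi> * ((\<beta> + 1) * int (l div gcd 2 l)) * int (gcd 2 l)" by (rule dvd_mult2)
        also have "\<dots> = \<xi> * (\<beta> + 1) * (int (l div gcd 2 l) * int (gcd 2 l))" by (simp only: mult.assoc)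
        also have "int (l div gcd 2 l) * int (gcd 2 l) = int l"
          using exceptional_exponent(1) by (simp add: zdiv_int)
        also have "\<xi> * (\<beta> + 1) * int l = (\<xi> * int l) * (\<beta> + 1)" by (simp add: ac_simps)
        finally have *: "int r ^ e dvd (\<xi> * int l) * (\<beta> + 1)" .
        have "\<not> int r dvd \<beta> + 1"
        proof
          assume "int r dvd \<beta> + 1"
          then have "int r dvd (\<beta> + 1) - (\<beta> - 1)" using r1 by (rule dvd_diff)
          then have "int r dvd int 2" by simp
          then have "r dvd 2" by (simp only: of_nat_dvd_iff)
          then show False using ne True r by (metis primes_dvd_imp_eq two_is_prime_nat)
        qed
        then have "coprime (int r ^ e) (\<beta> + 1)" using r by (simp add: prime_imp_coprime)
        with * show ?thesis by (simp add: coprime_dvd_mult_left_iff)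
      next
        case False
        with triv rm' show ?thesis by (auto simp: translation_part_trivial_def intro: dvd_trans)
      qed
      also have "\<dots> dvd \<xi> * int d" using \<open>l dvd d\<close> by (simp add: mult_dvd_mono)
      finally show ?thesis using r r1 by (intro power_dvd_mult_geom)
    qed
  qed simp
qed

section \<open>Necessity of condition (2)\<close>

text \<open>The iterate with exponent \<open>N\<close> is trivial modulo \<open>k\<close>. On the
  \<open>V\<close>-part this follows from \<open>l dvd N\<close> and the vanishing of
  \<open>\<xi>\<close>; at a prime of \<open>mU\<close>, the power dividing \<open>N\<close> also
  divides \<open>geom \<beta> N\<close>.\<close>

lemma dvd_iterate_diff:
  assumes "l dvd N" "k dvd m" "k dvd N"
  shows "int k dvd geom \<beta> N * ((\<beta> - 1) * u + \<xi>)"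
proof (rule dvd_of_prime_powers_dvd)
  show "k > 0" using assms m_pos by (auto intro: Nat.gr0I)
  fix q f k' assume q: "Factorial_Ring.prime q" and k: "k = q ^ f * k'"
  have qN: "q ^ f dvd N" and qm: "q ^ f dvd nV * mU" using assms by (auto simp: k m_eq)
  show "int q ^ f dvd geom \<beta> N * ((\<beta> - 1) * u + \<xi>)"
  proof (cases "q dvd mU")
    case True
    then show ?thesis using power_dvd_geom[OF prime_mU qN] q by simp
  next
    case False
    then have "coprime (q ^ f) mU" using q by (simp add: prime_imp_coprime)
    with qm have "q ^ f dvd nV" by (simp add: coprime_dvd_mult_left_iff)
    then have q': "int q ^ f dvd int nV" by (metis of_nat_dvd_iff of_nat_power)
    have "int q ^ f dvd (\<beta> - 1) * geom \<beta> N"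
      using dvd_trans[OF q' nV_dvd_power[OF \<open>l dvd N\<close>]] by (simp add: power_minus_one)
    moreover have "int q ^ f dvd \<xi>" using q' nV_dvd_xi by (rule dvd_trans)
    ultimately have "int q ^ f dvd ((\<beta> - 1) * geom \<beta> N) * u + geom \<beta> N * \<xi>" by simp
    then show ?thesis by (simp add: algebra_simps)
  qed
qed

text \<open>
  A translation by \<^term>\<open>Q\<close> of the \<^term>\<open>r\<close>-part alone preserves the orbits if it is achieved pointwise
  by iterates that fix the \<^term>\<open>r\<close>'-part.
\<close>

lemma local_translation:
  assumes trans: "\<And>T. (\<And>u. \<exists>k. [u + T = iterate k u] (mod (int m))) \<Longrightarrow> int m dvd T"
    and r: "Factorial_Ring.prime r" "m = r ^ e * m'" "\<not> r dvd m'"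
    and N: "l dvd N" "m' dvd N"
    and local: "\<And>u. \<exists>t. [geom \<beta> (N * t) * ((\<beta> - 1) * u + \<xi>) = Q] (mod (int r ^ e))"
  shows "int r ^ e dvd Q"
proof -
  have cop: "coprime (int r ^ e) (int m')" using r by (simp add: prime_imp_coprime)
  \<comment> \<open>\<open>T\<close> is \<open>Q\<close> in the \<open>r\<close>-part and 0
    elsewhere, matching the iterates with exponents \<open>N * t\<close>, which move nothing modulo
    \<open>m'\<close>.\<close>
  obtain T where T: "[T = Q] (mod (int r ^ e))" "[T = 0] (mod (int m'))"
    using binary_chinese_remainder_int[OF cop] by blast
  have "int m dvd T"
  proof (rule trans)
    fix u
    obtain t where t: "[geom \<beta> (N * t) * ((\<beta> - 1) * u + \<xi>) = Q] (mod (int r ^ e))"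
      using local by blast
    have "[geom \<beta> (N * t) * ((\<beta> - 1) * u + \<xi>) = T] (mod (int r ^ e))"
      using t cong_sym[OF T(1)] by (rule cong_trans)
    moreover have "[geom \<beta> (N * t) * ((\<beta> - 1) * u + \<xi>) = T] (mod (int m'))"
    proof -
      have "int m' dvd geom \<beta> (N * t) * ((\<beta> - 1) * u + \<xi>)"
        using N by (intro dvd_iterate_diff) (simp_all add: r(2))
      then have "[geom \<beta> (N * t) * ((\<beta> - 1) * u + \<xi>) = 0] (mod (int m'))" by (simp add: cong_0_iff)
      then show ?thesis using cong_sym[OF T(2)] by (rule cong_trans)
    qed
    ultimately have "[iterate (N * t) u - u = T] (mod (int r ^ e * int m'))"
      unfolding iterate_diff using cop by (rule coprime_cong_mult)
    then have "[u + T = iterate (N * t) u] (mod (int m))"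
      by (simp add: r(2) cong_iff_dvd_diff algebra_simps dvd_diff_commute)
    then show "\<exists>k. [u + T = iterate k u] (mod (int m))" ..
  qed
  then have "int r ^ e dvd T" by (auto simp: r(2) intro: dvd_mult_left)
  with T(1) show ?thesis by (simp add: cong_dvd_iff)
qed

text \<open>At each prime \<open>r\<close>, \<open>local_translation\<close> is applied with
  \<open>Q\<close> the \<open>r\<close>-part of condition (2). By \<open>xi_decomposition\<close>
  the displacements of all points carry the same power of \<open>r\<close>, so
  \<open>geom_solve\<close> finds for every point an iterate that moves it by
  \<open>Q\<close>.\<close>

lemma translation_part_trivialI:
  assumes trans: "\<And>T. (\<And>u. \<exists>k. [u + T = iterate k u] (mod (int m))) \<Longrightarrow> int m dvd T"
  shows "translation_part_trivial"
proof -
  have generic: "int r ^ e dvd \<xi> * int l"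
    if r: "Factorial_Ring.prime r" and m: "m = r ^ e * m'" and m': "\<not> r dvd m'"
      and ne: "\<not> (exceptional \<and> r = 2)" for r e m'
  \<comment> \<open>The second trivial case is split off because \<open>N\<close> below would be
    even, and the exact evaluation of \<open>geom \<beta> N\<close> at 2 would then need
    \<open>4 dvd \<beta> - 1\<close>.\<close>
  proof (cases "int r ^ e dvd \<xi> \<or> (r = 2 \<and> e \<le> 1 \<and> even l)")
    case True
    then show ?thesis
    proof
      assume "r = 2 \<and> e \<le> 1 \<and> even l"
      then show ?thesis by (cases e) auto
    qed simp
  next
    case False
    have rm: "r ^ e dvd m" by (simp add: m)
    obtain c \<xi>' B where xi: "\<xi> = int r ^ c * \<xi>'" "\<not> int r dvd \<xi>'" "\<beta> - 1 = int r ^ Suc c * B"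
      using xi_decomposition[OF r rm] False by blast
    have r1: "int r dvd \<beta> - 1" by (simp add: xi(3))
    obtain v l1 where l1: "l = r ^ v * l1" "\<not> r dvd l1" using prime_power_split r l_pos by blast
    \<comment> \<open>A multiple of \<open>l\<close> and of \<open>m'\<close>, as
      \<open>local_translation\<close> demands, with the same \<open>r\<close>-part as
      \<open>l\<close>.\<close>
    define N where "N = l * m'"
    have four: "4 dvd \<beta> - 1 \<or> (e \<le> 1 \<and> odd N)" if "r = 2"
    proof (cases "4 dvd m")
      case True
      then have "\<not> 4 dvd \<beta> + 1" using ne that by (simp add: exceptional_def cong_iff_dvd_diff)
      then show ?thesis using r1 that by presburger
    next
      case nfour: False
      have "e \<le> 1"
      proof (rule ccontr)
        assume "\<not> e \<le> 1"
        then have "(2::nat) ^ 2 dvd 2 ^ e" by (intro le_imp_power_dvd) simp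
        then show False using nfour rm that by (auto intro: dvd_trans)
      qed
      then show ?thesis using False that m' by (auto simp: N_def)
    qed
    have "\<not> r dvd l1 * m'" using l1 m' r by (simp add: prime_dvd_mult_iff)
    moreover have "N = r ^ v * (l1 * m')" by (simp add: N_def l1(1) mult.assoc)
    ultimately obtain s where s: "geom \<beta> N = int r ^ v * s" "\<not> int r dvd s"
      using geom_exact[OF r r1, of N v "l1 * m'"] four by blast
    show ?thesis
    proof (rule local_translation[OF trans r m m', where N = N])
      show "l dvd N" "m' dvd N" by (simp_all add: N_def)
      fix u
      \<comment> \<open>The unit part of the one-step displacement; its residue modulo
        \<open>r\<close> is that of \<open>\<xi>'\<close>, independently of
        \<open>u\<close>.\<close>
      define y where "y = \<xi>' + int r * (B * u)"
      have y: "(\<beta> - 1) * u + \<xi> = int r ^ c * y"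
        unfolding xi(3) by (simp add: xi(1) y_def algebra_simps)
      have "\<not> int r dvd y" using xi(2) by (simp add: y_def dvd_add_left_iff)
      then have "\<not> int r dvd s * y" using s(2) r by (simp add: prime_dvd_mult_iff)
      moreover have "int r dvd \<beta> ^ N - 1" using r1 by (simp add: power_minus_one)
      moreover have "4 dvd \<beta> ^ N - 1 \<or> e \<le> 1" if "r = 2"
        using four[OF that] by (auto simp: power_minus_one)
      ultimately obtain t where
        t: "[int r ^ (v + c) * (s * y) * geom (\<beta> ^ N) t = int r ^ (v + c) * (\<xi>' * int l1)] (mod (int r ^ e))"
        using geom_solve[OF r] by blast
      have "int r ^ (v + c) * (s * y) * geom (\<beta> ^ N) t = geom \<beta> (N * t) * ((\<beta> - 1) * u + \<xi>)"
        unfolding geom_mult s(1) y power_add by (simp only: ac_simps)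
      moreover have "int r ^ (v + c) * (\<xi>' * int l1) = \<xi> * int l"
        by (simp add: xi(1) l1(1) power_add ac_simps)
      ultimately show "\<exists>t. [geom \<beta> (N * t) * ((\<beta> - 1) * u + \<xi>) = \<xi> * int l] (mod (int r ^ e))"
        using t by auto
    qed
  qed
  define l' where "l' = l div gcd 2 l"
  have l'_l: "l' * gcd 2 l = l" by (simp add: l'_def)
  then have l'_pos: "l' > 0" using l_pos by (auto intro: Nat.gr0I)
  have l_dvd: "l dvd 2 * l'" using l'_l by (metis gcd_dvd1 mult.commute mult_dvd_mono dvd_refl)
  have special: "int r ^ e dvd \<xi> * ((\<beta> + 1) * int l')"
    if r: "Factorial_Ring.prime r" and m: "m = r ^ e * m'" and m': "\<not> r dvd m'"
      and ex: "exceptional" for r e m'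
  proof (cases "int r ^ e dvd \<xi>")
    case xi: False
    have rm: "r ^ e dvd m" by (simp add: m)
    show ?thesis
    proof (cases "r = 2")
      case False
      \<comment> \<open>At odd primes the division by \<open>gcd 2 l\<close> costs nothing, and
        \<open>generic\<close> suffices.\<close>
      then have "coprime r (gcd 2 l)"
        using r by (metis coprime_divisors dvd_refl gcd_dvd1 primes_coprime two_is_prime_nat)
      then have "coprime (int r ^ e) (int (gcd 2 l))" by (simp only: coprime_int_iff coprime_power_left_iff of_nat_power[symmetric] simp_thms disj_absorb)
      moreover have "int r ^ e dvd (\<xi> * int l') * int (gcd 2 l)"
        using generic[OF r m m'] False l'_l by (metis mult.assoc of_nat_mult)
      ultimately have "int r ^ e dvd \<xi> * int l'" by (simp add: coprime_dvd_mult_left_iff)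
      then have "int r ^ e dvd \<xi> * int l' * (\<beta> + 1)" by (rule dvd_mult2)
      then show ?thesis by (simp add: ac_simps)
    next
      case True
      have oddxi: "odd \<xi>" using exceptional_odd_xi[OF ex, of e] rm xi True by simp
      have oddb: "odd \<beta>" using dvd_beta_minus_one[OF r rm xi] True by simp
      obtain v l1 where l1: "l' = 2 ^ v * l1" "\<not> 2 dvd l1"
        using prime_power_split[OF two_is_prime_nat l'_pos] by blast
      \<comment> \<open>The step length is \<open>2 * M\<close>, so that the sums run over powers of
        \<open>\<beta> ^ 2\<close>. That square is 1 modulo 4, which makes \<open>geom_exact\<close>
        and \<open>geom_solve\<close> available at 2.\<close>
      define M where "M = l' * m'"
      define N where "N = 2 * M"
      have "4 dvd \<beta> ^ 2 - 1" using oddb by (auto elim!: oddE simp: power2_eq_square algebra_simps)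
      moreover have "\<not> 2 dvd l1 * m'" using l1 m' True by simp
      moreover have "M = 2 ^ v * (l1 * m')" by (simp add: M_def l1(1) mult.assoc)
      moreover have "int 2 dvd \<beta> ^ 2 - 1" using oddb by simp
      ultimately obtain s where s: "geom (\<beta> ^ 2) M = 2 ^ v * s" "odd s"
        using geom_exact[OF two_is_prime_nat, of "\<beta> ^ 2" M v "l1 * m'"] by auto
      show ?thesis
      proof (rule local_translation[OF trans r m m', where N = N])
        show "l dvd N" using l_dvd by (simp add: N_def M_def mult.assoc[symmetric])
        show "m' dvd N" by (simp add: N_def M_def)
        fix u
        define y where "y = (\<beta> - 1) * u + \<xi>"
        have "odd (s * y)" using s(2) oddb oddxi by (simp add: y_def)
        moreover have "4 dvd (\<beta> ^ 2) ^ M - 1" 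
          using \<open>4 dvd \<beta> ^ 2 - 1\<close> by (simp add: power_minus_one[of "\<beta>\<^sup>2"])
        moreover have "even ((\<beta> ^ 2) ^ M - 1)" using oddb by simp
        ultimately obtain t where
          t: "[2 ^ v * (s * y) * geom ((\<beta> ^ 2) ^ M) t = 2 ^ v * (\<xi> * int l1)] (mod (2 ^ e))"
          using geom_solve[OF two_is_prime_nat, of "(\<beta> ^ 2) ^ M" e "s * y" v "\<xi> * int l1"] by auto
        \<comment> \<open>The congruence was solved without the factor \<open>\<beta> + 1\<close>.
          It is put back here, as the contribution of the pairs of consecutive terms.\<close>
        have "geom \<beta> 2 = \<beta> + 1" by (simp add: numeral_2_eq_2 geom_Suc)
        then have "(\<beta> + 1) * (2 ^ v * (s * y) * geom ((\<beta> ^ 2) ^ M) t) = geom \<beta> (N * t) * y"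
          using geom_mult[of \<beta> 2 "M * t"] geom_mult[of "\<beta> ^ 2" M t]
          by (simp add: N_def s(1) ac_simps)
        moreover have "(\<beta> + 1) * (2 ^ v * (\<xi> * int l1)) = \<xi> * ((\<beta> + 1) * int l')"
          by (simp add: l1(1) ac_simps)
        ultimately have "[geom \<beta> (N * t) * y = \<xi> * ((\<beta> + 1) * int l')] (mod (2 ^ e))"
          using cong_scalar_left[OF t, of "\<beta> + 1"] by (simp only:)
        then show "\<exists>t. [geom \<beta> (N * t) * ((\<beta> - 1) * u + \<xi>) = \<xi> * ((\<beta> + 1) * int l')] (mod (int r ^ e))"
          using True by (auto simp: y_def)
      qed
    qed
  qed simp
  show ?thesis
  proof (cases exceptional)
    case True
    then have "int m dvd \<xi> * ((\<beta> + 1) * int l')"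
      using special dvd_of_prime_powers_dvd[OF m_pos] by blast
    with True show ?thesis by (simp add: translation_part_trivial_def exceptional_exponent l'_def)
  next
    case False
    then have "int m dvd \<xi> * int l"
      using generic dvd_of_prime_powers_dvd[OF m_pos] by blast
    with False show ?thesis by (simp add: translation_part_trivial_def)
  qed
qed

section \<open>Recognising orbit-preserving affine maps as iterates\<close>

text \<open>If the larger exponent is \<open>k + d\<close> and the smaller is \<open>k\<close>,
  cancelling the unit \<open>\<beta> ^ k\<close> shows that \<open>l\<close> divides
  \<open>d\<close>, and \<open>dvd_xi_geom\<close> applies to the difference.\<close>

lemma iterate_translation_cong:
  assumes triv: "translation_part_trivial" and "[\<beta> ^ i = \<beta> ^ j] (mod (int nV))"
    and parity: "exceptional \<Longrightarrow> even (\<xi> * (int i - int j))"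
  shows "[\<xi> * geom \<beta> i = \<xi> * geom \<beta> j] (mod (int m))"
proof -
  have *: "[\<xi> * geom \<beta> (k + d) = \<xi> * geom \<beta> k] (mod (int m))"
    if pow: "[\<beta> ^ (k + d) = \<beta> ^ k] (mod (int nV))" and par: "exceptional \<Longrightarrow> even (\<xi> * int d)" for k d
  proof -
    have "coprime (\<beta> ^ k) (int nV)" using coprime_nV_beta by (simp add: coprime_commute)
    moreover have "[\<beta> ^ k * \<beta> ^ d = \<beta> ^ k * 1] (mod (int nV))" using pow by (simp add: power_add)
    ultimately have "[\<beta> ^ d = 1] (mod (int nV))" using cong_mult_lcancel by blast
    then have "int m dvd \<xi> * geom \<beta> d" by (intro dvd_xi_geom triv par) (simp add: l_dvd_iff)
    then have "int m dvd \<beta> ^ k * (\<xi> * geom \<beta> d)" by (rule dvd_mult)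
    then show ?thesis unfolding geom_add by (simp add: cong_iff_dvd_diff distrib_left mult.left_commute)
  qed
  show ?thesis
  proof (cases "j \<le> i")
    case True
    then obtain d where "i = j + d" using le_Suc_ex by blast
    then show ?thesis using *[of j d] assms(2) parity by simp
  next
    case False
    then obtain d where "j = i + d" using le_Suc_ex[of i j] by auto
    then show ?thesis using *[of i d] cong_sym[OF assms(2)] parity by (simp add: cong_sym)
  qed
qed

text \<open>At the point \<open>c\<close> the linear part is invisible modulo \<open>mU\<close>, so
  \<open>k1\<close> determines \<open>j\<close>. At 1 and at \<open>c\<close> alike the linear part
  on \<open>V\<close> is \<open>\<gamma>\<close>, so \<open>k1\<close> and \<open>k2\<close> give
  the same translation part. Subtracting it at 1 leaves \<open>\<gamma>\<close>.\<close>

lemma orbit_preserving_iterate: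
  fixes \<gamma> j :: int
  assumes triv: "translation_part_trivial" and "coprime (int m) \<gamma>"
    and orb: "\<And>u. \<exists>k. [\<gamma> * u + j = iterate k u] (mod (int m))"
  obtains k where "[\<gamma> = \<beta> ^ k] (mod (int m))" "[j = \<xi> * geom \<beta> k] (mod (int m))"
proof -
  have nVm: "int nV dvd int m" and mUm: "int mU dvd int m" by (simp_all add: m_eq)
  have cop: "coprime (int nV) (int mU)" using coprime_parts by simp
  have xi0: "[\<xi> * z = 0] (mod (int nV))" for z using nV_dvd_xi by (simp add: cong_0_iff)
  have iterate_nV: "[iterate k u = \<beta> ^ k * u] (mod (int nV))" for k u
    unfolding iterate_def using nV_dvd_xi by (simp add: cong_iff_dvd_diff)
  obtain k0 where "[\<gamma> * 0 + j = iterate k0 0] (mod (int m))" using orb by blast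
  then have "[j = iterate k0 0] (mod (int nV))" using nVm by (simp add: cong_dvd_modulus)
  then have j0: "[j = 0] (mod (int nV))" using iterate_nV[of k0 0] by (auto intro: cong_trans)
  obtain c where c: "[c = 1] (mod (int nV))" "[c = 0] (mod (int mU))"
    using binary_chinese_remainder_int[OF cop] by blast
  have pow_nV: "[\<gamma> = \<beta> ^ k] (mod (int nV))"
    if "[\<gamma> * u + j = iterate k u] (mod (int m))" and u: "[u = 1] (mod (int nV))" for k u
  proof -
    have "[\<gamma> * u + j = iterate k u] (mod (int nV))" using that(1) nVm by (rule cong_dvd_modulus)
    then have "[\<gamma> * u + j = \<beta> ^ k * u] (mod (int nV))" using iterate_nV by (rule cong_trans)
    moreover have "[\<gamma> * u + j = \<gamma> * 1 + 0] (mod (int nV))"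
      using u j0 by (intro cong_add cong_mult cong_refl)
    moreover have "[\<beta> ^ k * u = \<beta> ^ k * 1] (mod (int nV))" using u by (rule cong_scalar_left)
    ultimately show ?thesis by simp (metis cong_sym cong_trans)
  qed
  obtain k1 where k1: "[\<gamma> * c + j = iterate k1 c] (mod (int m))" using orb by blast
  obtain k2 where k2: "[\<gamma> * 1 + j = iterate k2 1] (mod (int m))" using orb by blast
  have "[j = \<xi> * geom \<beta> k1] (mod (int mU))"
  proof -
    have "[\<gamma> * c + j = \<gamma> * 0 + j] (mod (int mU))" using c(2) by (intro cong_add cong_mult cong_refl)
    moreover have "[iterate k1 c = \<beta> ^ k1 * 0 + \<xi> * geom \<beta> k1] (mod (int mU))"
      unfolding iterate_def using c(2) by (intro cong_add cong_mult cong_refl)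
    moreover have "[\<gamma> * c + j = iterate k1 c] (mod (int mU))" using k1 mUm by (rule cong_dvd_modulus)
    ultimately show ?thesis by simp (metis cong_sym cong_trans)
  qed
  moreover have "[j = \<xi> * geom \<beta> k1] (mod (int nV))" using j0 cong_sym[OF xi0] by (rule cong_trans)
  ultimately have jm: "[j = \<xi> * geom \<beta> k1] (mod (int m))"
    using coprime_cong_mult[OF _ _ cop] by (simp add: m_eq)
  have "[\<beta> ^ k1 = \<beta> ^ k2] (mod (int nV))"
    using cong_trans[OF cong_sym[OF pow_nV[OF k1 c(1)]] pow_nV[OF k2]] by simp
  \<comment> \<open>Modulo 2 all linear parts are 1 and \<open>geom \<beta> k\<close> is
    \<open>k\<close>, so \<open>j\<close> is congruent to both \<open>\<xi> * k1\<close> and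
    \<open>\<xi> * k2\<close>.\<close>
  moreover have "even (\<xi> * (int k1 - int k2))" if "exceptional"
  proof -
    have "(2::int) dvd 4" by simp
    also have "4 dvd int m" using that by (rule exceptional_4_dvd)
    finally have m2: "2 dvd int m" .
    have oddg: "odd \<gamma>"
      using \<open>coprime (int m) \<gamma>\<close> m2 by (meson coprime_common_divisor odd_one)
    have oddb: "odd \<beta>"
      using coprime_beta m2 by (meson coprime_common_divisor odd_one)
    have par: "even (geom \<beta> k) \<longleftrightarrow> even k" for k
      using geom_cong_int[of 2 \<beta> k] oddb by (simp add: cong_dvd_iff)
    have "2 dvd j - \<xi> * geom \<beta> k1" "2 dvd \<gamma> * 1 + j - iterate k2 1"
      using dvd_trans[OF m2] jm k2 by (simp_all only: cong_iff_dvd_diff)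
    with oddg oddb show ?thesis by (auto simp: iterate_def par)
  qed
  ultimately have "[\<xi> * geom \<beta> k1 = \<xi> * geom \<beta> k2] (mod (int m))"
    by (rule iterate_translation_cong[OF triv])
  with jm have jm2: "[j = \<xi> * geom \<beta> k2] (mod (int m))" by (rule cong_trans)
  moreover have "[\<gamma> = \<beta> ^ k2] (mod (int m))"
  proof -
    have "[\<gamma> * 1 + j - j = iterate k2 1 - \<xi> * geom \<beta> k2] (mod (int m))"
      using k2 jm2 by (rule cong_diff)
    then show ?thesis by (simp add: iterate_def)
  qed
  ultimately show ?thesis using that by blast
qed

text \<open>The theorem in arithmetic form. Linear parts live modulo \<open>n\<close>, but orbits
  see them only modulo \<open>m\<close>: condition (2) identifies an orbit-preserving map with an
  iterate modulo \<open>m\<close>, and condition (1) corrects the exponent so that the linear parts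
  agree modulo \<open>n\<close>.\<close>

lemma closed_iff:
  fixes \<alpha> :: int
  assumes "m dvd n" "n > 0" and coprime_alpha: "coprime (int n) \<alpha>" and beta: "[\<beta> = \<alpha> ^ B] (mod (int n))"
    and trivial: "\<And>k. [\<beta> ^ k = 1] (mod (int n)) \<Longrightarrow> int m dvd \<xi> * geom \<beta> k"
  shows "(\<forall>(i::nat) (j::int). (\<forall>u. \<exists>k. [\<alpha> ^ i * u + j = iterate k u] (mod (int m))) \<longrightarrow>
        (\<exists>k. [\<alpha> ^ i = \<beta> ^ k] (mod (int n)) \<and> [j = \<xi> * geom \<beta> k] (mod (int m)))) \<longleftrightarrow>
     (\<exists>k. [\<alpha> ^ ord (int m) \<alpha> = \<beta> ^ k] (mod (int n))) \<and> translation_part_trivial"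
    (is "?closed \<longleftrightarrow> ?ker \<and> _")
proof
  assume closed: ?closed
  let ?o = "ord (int m) \<alpha>"
  have "[\<alpha> ^ ?o = 1] (mod (int m))" using ord_int_dvd_iff[OF m_pos, of \<alpha> ?o] by simp
  then have "[\<alpha> ^ ?o * u + 0 = iterate 0 u] (mod (int m))" for u
    using cong_scalar_right[of "\<alpha> ^ ?o" 1 _ u] by (simp add: iterate_def)
  with closed have ?ker by blast
  moreover have translation_part_trivial
  proof (rule translation_part_trivialI)
    fix T assume "\<And>u. \<exists>k. [u + T = iterate k u] (mod (int m))"
    then have "\<forall>u. \<exists>k. [\<alpha> ^ 0 * u + T = iterate k u] (mod (int m))" by simp
    with closed obtain k where k: "[\<alpha> ^ 0 = \<beta> ^ k] (mod (int n))" "[T = \<xi> * geom \<beta> k] (mod (int m))" by blast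
    then have "int m dvd \<xi> * geom \<beta> k" by (intro trivial) (simp add: cong_sym_eq)
    with k(2) show "int m dvd T" by (simp add: cong_dvd_iff)
  qed
  ultimately show "?ker \<and> translation_part_trivial" ..
next
  assume "?ker \<and> translation_part_trivial"
  then obtain k0 where k0: "[\<alpha> ^ ord (int m) \<alpha> = \<beta> ^ k0] (mod (int n))" and triv: translation_part_trivial by blast
  have mn: "int m dvd int n" using \<open>m dvd n\<close> by simp
  have coprime_beta_n: "coprime (int n) \<beta>"
    using cong_imp_coprime[OF cong_sym[OF beta]] coprime_alpha by (simp add: coprime_commute)
  show ?closed
  proof (intro allI impI)
    fix i :: nat and j :: int
    assume orb: "\<forall>u. \<exists>k. [\<alpha> ^ i * u + j = iterate k u] (mod (int m))"
    have "coprime (int m) (\<alpha> ^ i)"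
      using coprime_divisors[OF mn dvd_refl coprime_alpha] by simp
    then obtain k where k: "[\<alpha> ^ i = \<beta> ^ k] (mod (int m))" "[j = \<xi> * geom \<beta> k] (mod (int m))"
      using orbit_preserving_iterate[OF triv] orb by blast
    \<comment> \<open>A natural exponent for which \<open>\<beta> ^ k'\<close> is inverse to
      \<open>\<beta> ^ k\<close> modulo \<open>n\<close>.\<close>
    define k' where "k' = k * (ord (int n) \<beta> - 1)"
    have "k + k' = k * ord (int n) \<beta>"
      using ord_int_pos[OF \<open>n > 0\<close> coprime_beta_n] by (cases "ord (int n) \<beta>") (simp_all add: k'_def)
    then have kk': "[\<beta> ^ (k + k') = 1] (mod (int n))" by (simp flip: ord_int_dvd_iff[OF \<open>n > 0\<close>])
    \<comment> \<open>The quotient of \<open>\<alpha> ^ i\<close> by \<open>\<beta> ^ k\<close>,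
      written as a power of \<open>\<alpha>\<close>. It is 1 modulo \<open>m\<close>, hence a power
      of the element in condition (1).\<close>
    have alpha: "[\<alpha> ^ (i + B * k') = \<alpha> ^ i * \<beta> ^ k'] (mod (int n))"
      unfolding power_add power_mult using cong_sym[OF beta] by (intro cong_mult cong_pow cong_refl)
    have "[\<alpha> ^ (i + B * k') = 1] (mod (int m))"
    proof -
      have "[\<alpha> ^ (i + B * k') = \<alpha> ^ i * \<beta> ^ k'] (mod (int m))" using alpha mn by (rule cong_dvd_modulus)
      also have "[\<alpha> ^ i * \<beta> ^ k' = \<beta> ^ k * \<beta> ^ k'] (mod (int m))" using k(1) by (rule cong_scalar_right)
      also have "[\<beta> ^ k * \<beta> ^ k' = 1] (mod (int m))" using kk' mn unfolding power_add by (rule cong_dvd_modulus)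
      finally show ?thesis .
    qed
    then obtain t where "i + B * k' = ord (int m) \<alpha> * t" unfolding ord_int_dvd_iff[OF m_pos, symmetric] by (elim dvdE)
    then have "\<alpha> ^ (i + B * k') = (\<alpha> ^ ord (int m) \<alpha>) ^ t" by (simp add: power_mult)
    with k0 have "[\<alpha> ^ (i + B * k') = \<beta> ^ (k0 * t)] (mod (int n))" by (simp add: power_mult cong_pow)
    with alpha have pow: "[\<alpha> ^ i * \<beta> ^ k' = \<beta> ^ (k0 * t)] (mod (int n))" by (metis cong_sym cong_trans)
    \<comment> \<open>The exponent correction that turns the congruence modulo \<open>m\<close> into
      one modulo \<open>n\<close>.\<close>
    define d where "d = k0 * t"
    have a: "[\<alpha> ^ i = \<beta> ^ (k + d)] (mod (int n))"
    proof -
      have "[\<alpha> ^ i * \<beta> ^ (k + k') = \<alpha> ^ i * 1] (mod (int n))" using kk' by (rule cong_scalar_left)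
      then have "[\<alpha> ^ i = \<alpha> ^ i * \<beta> ^ k' * \<beta> ^ k] (mod (int n))" by (simp add: power_add ac_simps cong_sym_eq)
      also have "[\<alpha> ^ i * \<beta> ^ k' * \<beta> ^ k = \<beta> ^ d * \<beta> ^ k] (mod (int n))"
        using pow unfolding d_def by (rule cong_scalar_right)
      finally show ?thesis by (simp add: power_add mult.commute)
    qed
    have eq: "[\<beta> ^ (k + d) = \<beta> ^ k] (mod (int m))"
      using cong_dvd_modulus[OF a mn] k(1) by (metis cong_sym cong_trans)
    have "[\<xi> * geom \<beta> (k + d) = \<xi> * geom \<beta> k] (mod (int m))"
    proof (rule iterate_translation_cong[OF triv])
      show "[\<beta> ^ (k + d) = \<beta> ^ k] (mod (int nV))" using eq by (rule cong_dvd_modulus) (simp add: m_eq)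
      assume ex: exceptional
      then have 4: "4 dvd int m" by (rule exceptional_4_dvd)
      \<comment> \<open>Since 4 divides \<open>m\<close>, the correction by \<open>d\<close> must
        preserve the sign of the linear part modulo 4, which forces \<open>d\<close> to be
        even.\<close>
      have b: "[\<beta> ^ e = (- 1) ^ e] (mod 4)" for e using ex by (intro cong_pow) (simp add: exceptional_def)
      have "[\<beta> ^ (k + d) = \<beta> ^ k] (mod 4)" using eq 4 by (rule cong_dvd_modulus)
      then have "[(- 1) ^ (k + d) = (- 1 :: int) ^ k] (mod 4)"
        using b[of k] b[of "k + d"] by (metis cong_sym cong_trans)
      then have "even d"
        by (cases "even k"; cases "even d") (simp_all add: power_add cong_def)
      then show "even (\<xi> * (int (k + d) - int k))" by simp
    qed
    with k(2) have "[j = \<xi> * geom \<beta> (k + d)] (mod (int m))" by (metis cong_sym cong_trans)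
    with a show "\<exists>k. [\<alpha> ^ i = \<beta> ^ k] (mod (int n)) \<and> [j = \<xi> * geom \<beta> k] (mod (int m))" by blast
  qed
qed

end

section \<open>Relative closures of subgroups\<close>

lemma card_range_cong:
  fixes f :: "int \<Rightarrow> 'a"
  assumes "p > 0" and f: "\<And>i j. f i = f j \<longleftrightarrow> int p dvd i - j"
  shows "card (range f) = p"
proof -
  have "range f = f ` (int ` {..<p})"
  proof (intro equalityI subsetI)
    fix y assume "y \<in> range f"
    then obtain i where "y = f i" by blast
    also have "f i = f (int (nat (i mod int p)))"
      using assms by (simp add: f minus_mod_eq_mult_div)
    finally show "y \<in> f ` (int ` {..<p})"
      using \<open>p > 0\<close> by (intro image_eqI[where x = "int (nat (i mod int p))"] imageI) (simp_all add: nat_less_iff)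
  qed blast
  moreover have "inj_on f (int ` {..<p})"
  proof (rule inj_onI, clarsimp simp: f)
    fix i j assume "i < p" "j < p" "int p dvd int i - int j"
    then show "i = j" by (metis cong_iff_dvd_diff cong_int_iff cong_less_modulus_unique_nat)
  qed
  ultimately have "card (range f) = card (int ` {..<p})" by (simp add: card_image)
  then show ?thesis by (simp add: card_image)
qed

context group
begin

lemma conj_int_pow:
  assumes "g \<in> carrier G" "z \<in> carrier G"
  shows "inv g \<otimes> z [^] (u::int) \<otimes> g = (inv g \<otimes> z \<otimes> g) [^] u"
proof -
  have "(\<lambda>z. inv g \<otimes> z \<otimes> g) \<in> hom G G"
    using assms(1) by (auto simp: hom_def m_assoc inv_solve_left' simp flip: m_assoc[of g "inv g"])
  then show ?thesis using hom_int_pow[of _ G G z u] assms(2) is_group by blast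
qed

lemma int_pow_conj_swap:
  assumes "g \<in> carrier G" "z \<in> carrier G" "inv g \<otimes> z \<otimes> g = z [^] (c::int)"
  shows "z [^] (u::int) \<otimes> g [^] (k::nat) = g [^] k \<otimes> z [^] (c ^ k * u)"
proof (induction k arbitrary: u)
  case (Suc k)
  have *: "z [^] v \<otimes> g = g \<otimes> z [^] (c * v)" for v :: int
  proof -
    have "inv g \<otimes> z [^] v \<otimes> g = z [^] (c * v)"
      using conj_int_pow[OF assms(1,2), of v] assms by (simp add: int_pow_pow)
    then show ?thesis using assms(1,2)
      by (metis int_pow_closed inv_closed inv_solve_left m_assoc m_closed)
  qed
  have "z [^] u \<otimes> g [^] Suc k = g [^] k \<otimes> (z [^] (c ^ k * u) \<otimes> g)"
    using assms(1,2) by (simp add: Suc flip: m_assoc)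
  also have "\<dots> = g [^] Suc k \<otimes> z [^] (c ^ Suc k * u)"
    using assms(1,2) by (simp add: * m_assoc mult.assoc)
  finally show ?case .
qed (use assms in simp)

lemma generate_subgroup: "subgroup S G \<Longrightarrow> generate G S = S"
  using generateI[of S S] by simp

lemma subgroup_rcos_eq_iff:
  assumes "subgroup S G" "u \<in> carrier G" "v \<in> carrier G"
  shows "S #> u = S #> v \<longleftrightarrow> u \<otimes> inv v \<in> S"
proof
  assume "S #> u = S #> v"
  then have "u \<in> S #> v" using rcos_self[OF assms(2,1)] by simp
  then show "u \<otimes> inv v \<in> S" using subgroup.rcos_module_imp[OF assms(1)] is_group assms by blast
next
  assume "u \<otimes> inv v \<in> S"
  then have "u \<in> S #> v" using subgroup.rcos_module_rev[OF assms(1)] is_group assms by blast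
  then show "S #> u = S #> v" using repr_independence assms by metis
qed

end

context group_action
begin

text \<open>\<open>C\<close> is the explicit candidate for the relative closure: the elements that
  move every point within its \<open>H\<close>-orbit.\<close>

lemma orbit_preserving_subgroup:
  assumes H: "subgroup H G"
  defines "C \<equiv> {g \<in> carrier G. \<forall>q\<in>E. \<phi> g q \<in> orbit (G\<lparr>carrier := H\<rparr>) \<phi> q}"
  shows "subgroup C G" "H \<subseteq> C"
proof -
  interpret group G using group_hom by (rule group_hom.axioms)
  interpret H: subgroup H G by (rule H)
  have orb: "p \<in> orbit (G\<lparr>carrier := H\<rparr>) \<phi> q \<longleftrightarrow> (\<exists>h\<in>H. p = \<phi> h q)" for p q
    by (auto simp: orbit_def)
  show "H \<subseteq> C" by (auto simp: C_def orb)
  show "subgroup C G"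
  proof
    show "C \<subseteq> carrier G" by (auto simp: C_def)
    show "\<one> \<in> C" using \<open>H \<subseteq> C\<close> H.one_closed by blast
  next
    fix g h assume g: "g \<in> C" and h: "h \<in> C"
    show "g \<otimes> h \<in> C"
      unfolding C_def mem_Collect_eq orb
    proof (intro conjI ballI)
      show "g \<otimes> h \<in> carrier G" using g h by (simp add: C_def)
      fix q assume q: "q \<in> E"
      obtain h1 where h1: "h1 \<in> H" "\<phi> h q = \<phi> h1 q" using h q by (auto simp: C_def orb)
      have hq: "\<phi> h q \<in> E" using element_image h q by (auto simp: C_def)
      obtain h2 where h2: "h2 \<in> H" "\<phi> g (\<phi> h q) = \<phi> h2 (\<phi> h q)" using g hq by (auto simp: C_def orb)
      have "\<phi> (g \<otimes> h) q = \<phi> (h2 \<otimes> h1) q"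
        using composition_rule q g h h1 h2 by (simp add: C_def)
      then show "\<exists>k\<in>H. \<phi> (g \<otimes> h) q = \<phi> k q" using h1 h2 by blast
    qed
  next
    fix g assume g: "g \<in> C"
    show "inv g \<in> C"
      unfolding C_def mem_Collect_eq orb
    proof (intro conjI ballI)
      show ig: "inv g \<in> carrier G" using g by (simp add: C_def)
      fix q assume q: "q \<in> E"
      \<comment> \<open>The defining property of \<open>g\<close> is used at the preimage
        \<open>p\<close>, which puts \<open>q\<close> in the orbit of \<open>p\<close>; the relation
        is then reversed inside \<open>H\<close>.\<close>
      define p where "p = \<phi> (inv g) q"
      have p: "p \<in> E" using element_image ig q by (auto simp: p_def)
      have "\<phi> g p = q" using orbit_sym_aux[OF ig q p_def[symmetric]] g by (simp add: C_def)
      then obtain h where h: "h \<in> H" "\<phi> h p = q" using g p by (force simp: C_def orb)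
      then have "p = \<phi> (inv h) q" using orbit_sym_aux p by (metis H.mem_carrier)
      then show "\<exists>k\<in>H. \<phi> (inv g) q = \<phi> k q" using h by (auto simp: p_def)
    qed
  qed
qed

text \<open>The orbit-preserving elements have the same orbits as \<open>H\<close> and contain every
  subgroup with those orbits, so they are the greatest one.\<close>

lemma relative_closure_eq:
  assumes H: "subgroup H G"
  shows "relative_closure G E \<phi> H = {g \<in> carrier G. \<forall>q\<in>E. \<phi> g q \<in> orbit (G\<lparr>carrier := H\<rparr>) \<phi> q}"
    (is "_ = ?C")
proof -
  interpret group G using group_hom by (rule group_hom.axioms)
  interpret H: subgroup H G by (rule H)
  have orb: "p \<in> orbit (G\<lparr>carrier := K\<rparr>) \<phi> q \<longleftrightarrow> (\<exists>h\<in>K. p = \<phi> h q)" for p K q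
    by (auto simp: orbit_def)
  show ?thesis
    unfolding relative_closure_def
  proof (rule Greatest_equality)
    have "orbit (G\<lparr>carrier := ?C\<rparr>) \<phi> q = orbit (G\<lparr>carrier := H\<rparr>) \<phi> q" if "q \<in> E" for q
    proof (intro equalityI subsetI)
      fix p assume "p \<in> orbit (G\<lparr>carrier := ?C\<rparr>) \<phi> q"
      then show "p \<in> orbit (G\<lparr>carrier := H\<rparr>) \<phi> q" unfolding orb[of p ?C] using that by blast
    next
      fix p assume "p \<in> orbit (G\<lparr>carrier := H\<rparr>) \<phi> q"
      then show "p \<in> orbit (G\<lparr>carrier := ?C\<rparr>) \<phi> q"
        unfolding orb[of p] using orbit_preserving_subgroup(2)[OF H] by blast
    qed
    then have "orbits (G\<lparr>carrier := ?C\<rparr>) E \<phi> = orbits (G\<lparr>carrier := H\<rparr>) E \<phi>"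
      unfolding orbits_def Setcompr_eq_image by (intro image_cong refl)
    then show "subgroup ?C G \<and> orbits (G\<lparr>carrier := ?C\<rparr>) E \<phi> = orbits (G\<lparr>carrier := H\<rparr>) E \<phi>"
      using orbit_preserving_subgroup(1)[OF H] by blast
  next
    fix K assume K: "subgroup K G \<and> orbits (G\<lparr>carrier := K\<rparr>) E \<phi> = orbits (G\<lparr>carrier := H\<rparr>) E \<phi>"
    then have KG: "subgroup K G" ..
    interpret K: subgroup K G by (rule KG)
    show "K \<le> ?C"
    proof
      fix g assume g: "g \<in> K"
      have gG: "g \<in> carrier G" using g by (rule K.mem_carrier)
      moreover have "\<phi> g q \<in> orbit (G\<lparr>carrier := H\<rparr>) \<phi> q" if q: "q \<in> E" for q
      proof -
        \<comment> \<open>Equality of the sets of orbits gives only some base point \<open>p\<close>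
          with this orbit. The passage from \<open>q\<close> to its image under \<open>g\<close> is
          therefore made through \<open>p\<close> by two elements of \<open>H\<close>.\<close>
        have "orbit (G\<lparr>carrier := K\<rparr>) \<phi> q \<in> orbits (G\<lparr>carrier := H\<rparr>) E \<phi>"
          using K q by (auto simp: orbits_def)
        then obtain p where p: "p \<in> E" "orbit (G\<lparr>carrier := K\<rparr>) \<phi> q = orbit (G\<lparr>carrier := H\<rparr>) \<phi> p"
          by (auto simp: orbits_def)
        have "\<phi> \<one> q = q" using id_eq_one q by (metis restrict_apply')
        then have "q \<in> orbit (G\<lparr>carrier := K\<rparr>) \<phi> q" unfolding orb using K.one_closed by metis
        then obtain h where h: "h \<in> H" "q = \<phi> h p" unfolding p(2) orb by blast
        have "\<phi> g q \<in> orbit (G\<lparr>carrier := K\<rparr>) \<phi> q" using g by (auto simp: orb)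
        then obtain h' where h': "h' \<in> H" "\<phi> g q = \<phi> h' p" unfolding p(2) orb by blast
        have hG: "h \<in> carrier G" "h' \<in> carrier G" using h(1) h'(1) by (simp_all add: H.mem_carrier)
        have "p = \<phi> (inv h) q" using orbit_sym_aux h(2) p(1) hG(1) by metis
        then have "\<phi> g q = \<phi> (h' \<otimes> inv h) q" using composition_rule h'(2) q hG by simp
        then show ?thesis unfolding orb using h(1) h'(1) H.m_closed H.m_inv_closed by blast
      qed
      ultimately show "g \<in> ?C" by blast
    qed
  qed
qed

lemma relatively_closed_iff:
  assumes H: "subgroup H G"
  shows "relatively_closed G E \<phi> H \<longleftrightarrow>
    (\<forall>g\<in>carrier G. (\<forall>q\<in>E. \<phi> g q \<in> orbit (G\<lparr>carrier := H\<rparr>) \<phi> q) \<longrightarrow> g \<in> H)"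
  unfolding relatively_closed_def relative_closure_eq[OF H]
  using orbit_preserving_subgroup(2)[OF H] by blast

end

section \<open>Cyclic regular normal subgroups\<close>

locale cyclic_regular_action = faithful_action G \<Omega> \<phi>
  for G :: "('g, 'm) monoid_scheme" (structure) and \<Omega> :: "'p set" and \<phi> +
  fixes \<omega> :: 'p and w a :: 'g and \<alpha> :: int
  assumes finite_carrier: "finite (carrier G)"
    and regular: "regular_subgroup G \<Omega> \<phi> (generate G {w})"
    and w [simp]: "w \<in> carrier G" and a [simp]: "a \<in> carrier G" and omega: "\<omega> \<in> \<Omega>"
    and stabilizer_eq: "stabilizer G \<phi> \<omega> = generate G {a}"
    and conj_w: "inv a \<otimes> w \<otimes> a = w [^] \<alpha>"
begin

sublocale group G using group_hom by (rule group_hom.axioms)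

definition n :: nat where "n = ord w"

lemma n_pos: "n > 0"
  using ord_ge_1[OF finite_carrier w] by (simp add: n_def)

lemma W_eq: "generate G {w} = range (\<lambda>i::int. w [^] i)"
  by (auto simp: generate_pow)

text \<open>Natural exponents suffice by finiteness, and keep \<open>\<alpha> ^ i\<close> an
  integer.\<close>

lemma A_eq: "generate G {a} = range (\<lambda>i::nat. a [^] i)"
  by (auto simp: generate_pow_on_finite_carrier[OF finite_carrier])

lemma w_pow_eq_iff: "w [^] (i::int) = w [^] (j::int) \<longleftrightarrow> [i = j] (mod (int n))"
  by (simp add: int_pow_eq n_def cong_iff_dvd_diff dvd_diff_commute)

lemma w_pow_mult: "w [^] (i::int) \<otimes> w [^] (j::int) = w [^] (i + j)"
  by (simp add: int_pow_mult)

lemma w_swap: "w [^] (u::int) \<otimes> a [^] (k::nat) = a [^] k \<otimes> w [^] (\<alpha> ^ k * u)"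
  by (rule int_pow_conj_swap) (simp_all add: conj_w)

section \<open>Affine coordinates on \<Omega>\<close>

text \<open>The coordinate \<open>u\<close> of a point is the exponent of the translation carrying
  \<open>\<omega>\<close> to it in the right action; the inverse converts to the left action
  \<open>\<phi>\<close>.\<close>

definition point :: "int \<Rightarrow> 'p" where "point u = \<phi> (inv (w [^] u)) \<omega>"

lemma point_in: "point u \<in> \<Omega>"
  unfolding point_def by (rule element_image[OF _ omega refl]) simp

lemma regularD:
  assumes "p \<in> \<Omega>" "q \<in> \<Omega>"
  shows "\<exists>!g. g \<in> generate G {w} \<and> \<phi> g p = q"
  using regular assms by (auto simp: regular_subgroup_def)

lemma point_surj:
  assumes "q \<in> \<Omega>"
  obtains u where "q = point u"
proof -
  obtain i :: int where "\<phi> (w [^] i) \<omega> = q"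
    using regularD[OF omega assms] by (auto simp: W_eq)
  then have "q = point (- i)" by (simp add: point_def int_pow_neg)
  then show ?thesis by (rule that)
qed

lemma point_eq_iff: "point u = point v \<longleftrightarrow> [u = v] (mod (int n))"
proof
  have mem: "inv (w [^] i) \<in> generate G {w}" for i :: int
    unfolding W_eq by (simp flip: int_pow_neg)
  assume "point u = point v"
  then have "inv (w [^] u) = inv (w [^] v)"
    using regularD[OF omega point_in[of u]] mem unfolding point_def by metis
  then have "w [^] u = w [^] v" by (metis inv_inv int_pow_closed w)
  then show "[u = v] (mod (int n))" by (simp add: w_pow_eq_iff)
next
  assume "[u = v] (mod (int n))"
  then show "point u = point v" unfolding point_def by (metis w_pow_eq_iff)
qed

text \<open>Moving the power of \<open>a\<close> to the front of the product of translations turns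
  the exponent \<open>u\<close> into \<open>\<alpha> ^ i * u + j\<close>, and the power of
  \<open>a\<close> is absorbed by the stabilizer of \<open>\<omega>\<close>.\<close>

lemma act_point: "\<phi> (inv (a [^] (i::nat) \<otimes> w [^] (j::int))) (point u) = point (\<alpha> ^ i * u + j)"
proof -
  have "a [^] i \<in> stabilizer G \<phi> \<omega>" unfolding stabilizer_eq A_eq by simp
  then have "\<phi> (a [^] i) \<omega> = \<omega>" by (simp add: stabilizer_def)
  then have stab: "\<phi> (inv (a [^] i)) \<omega> = \<omega>" using orbit_sym_aux omega by simp
  have "\<phi> (inv (a [^] i \<otimes> w [^] j)) (point u) = \<phi> (inv (a [^] i \<otimes> w [^] j) \<otimes> inv (w [^] u)) \<omega>"
    unfolding point_def using omega by (simp add: composition_rule)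
  also have "inv (a [^] i \<otimes> w [^] j) \<otimes> inv (w [^] u) = inv (w [^] u \<otimes> a [^] i \<otimes> w [^] j)"
    by (simp add: inv_mult_group m_assoc)
  also have "w [^] u \<otimes> a [^] i \<otimes> w [^] j = a [^] i \<otimes> w [^] (\<alpha> ^ i * u + j)"
    by (simp add: w_swap m_assoc w_pow_mult)
  also have "\<phi> (inv \<dots>) \<omega> = \<phi> (inv (w [^] (\<alpha> ^ i * u + j))) (\<phi> (inv (a [^] i)) \<omega>)"
    using omega by (simp add: inv_mult_group composition_rule)
  finally show ?thesis by (simp add: stab point_def)
qed

text \<open>Evaluation at the point with coordinate 1 gives one direction. Faithfulness gives the
  other, since congruent multipliers define the same permutation.\<close>

lemma a_pow_eq_iff: "a [^] (i::nat) = a [^] (k::nat) \<longleftrightarrow> [\<alpha> ^ i = \<alpha> ^ k] (mod (int n))"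
proof
  assume eq: "a [^] i = a [^] k"
  have "point (\<alpha> ^ i * 1 + 0) = point (\<alpha> ^ k * 1 + 0)"
    unfolding act_point[symmetric] eq ..
  then show "[\<alpha> ^ i = \<alpha> ^ k] (mod (int n))" by (simp add: point_eq_iff)
next
  assume cong: "[\<alpha> ^ i = \<alpha> ^ k] (mod (int n))"
  have "\<phi> (inv (a [^] i)) q = \<phi> (inv (a [^] k)) q" if q: "q \<in> \<Omega>" for q
  proof -
    obtain u where "q = point u" using q by (rule point_surj)
    moreover have "[\<alpha> ^ i * u = \<alpha> ^ k * u] (mod (int n))" using cong by (rule cong_scalar_right)
    ultimately show ?thesis using act_point[of i 0 u] act_point[of k 0 u] by (simp add: point_eq_iff)
  qed
  \<comment> \<open>Permutations are extensional functions, so agreement on \<Omega> is enough for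
    equality.\<close>
  moreover have "\<phi> g \<in> extensional \<Omega>" if "g \<in> carrier G" for g
    using bij_prop0[OF that] by (simp add: Bij_def)
  ultimately have "\<phi> (inv (a [^] i)) = \<phi> (inv (a [^] k))"
    by (intro extensionalityI[of _ \<Omega>]) simp_all
  then have "inv (a [^] i) = inv (a [^] k)" using faithful by (auto simp: inj_on_def)
  then show "a [^] i = a [^] k" by (metis inv_inv nat_pow_closed a)
qed

lemma element_eq_iff:
  "a [^] (i::nat) \<otimes> w [^] (j::int) = a [^] (i'::nat) \<otimes> w [^] (j'::int) \<longleftrightarrow>
    [\<alpha> ^ i = \<alpha> ^ i'] (mod (int n)) \<and> [j = j'] (mod (int n))"
proof
  assume eq: "a [^] i \<otimes> w [^] j = a [^] i' \<otimes> w [^] j'"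
  have "point (\<alpha> ^ i * 0 + j) = point (\<alpha> ^ i' * 0 + j')" unfolding act_point[symmetric] eq ..
  then have j: "[j = j'] (mod (int n))" by (simp add: point_eq_iff)
  then have "w [^] j = w [^] j'" by (simp add: w_pow_eq_iff)
  with eq have "a [^] i = a [^] i'" by simp
  with j show "[\<alpha> ^ i = \<alpha> ^ i'] (mod (int n)) \<and> [j = j'] (mod (int n))" by (simp add: a_pow_eq_iff)
next
  assume *: "[\<alpha> ^ i = \<alpha> ^ i'] (mod (int n)) \<and> [j = j'] (mod (int n))"
  then have "a [^] i = a [^] i'" "w [^] j = w [^] j'" unfolding a_pow_eq_iff w_pow_eq_iff by simp_all
  then show "a [^] i \<otimes> w [^] j = a [^] i' \<otimes> w [^] j'" by simp
qed

text \<open>By regularity some translation moves \<open>\<omega>\<close> as \<open>g\<close> does;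
  dividing it out leaves an element of the stabilizer, a power of \<open>a\<close>.\<close>

lemma element_decomposition:
  assumes g: "g \<in> carrier G"
  obtains i :: nat and j :: int where "g = a [^] i \<otimes> w [^] j"
proof -
  obtain j where j: "\<phi> (inv g) \<omega> = point j"
    using point_surj element_image[OF inv_closed[OF g] omega refl] by metis
  define c where "c = g \<otimes> inv (w [^] j)"
  have c: "c \<in> carrier G" using g by (simp add: c_def)
  have "\<phi> (inv c) \<omega> = \<phi> (w [^] j) (\<phi> (inv g) \<omega>)"
    using g omega by (simp add: c_def inv_mult_group composition_rule)
  also have "\<dots> = \<phi> (w [^] j \<otimes> inv (w [^] j)) \<omega>"
    unfolding j point_def by (rule composition_rule[symmetric]) (simp_all add: omega)
  also have "\<dots> = \<omega>" using id_eq_one omega by simp (metis restrict_apply')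
  finally have "\<phi> c \<omega> = \<omega>" using orbit_sym_aux[of "inv c" \<omega> \<omega>] c omega by simp
  then have "c \<in> generate G {a}" using c by (simp add: stabilizer_def flip: stabilizer_eq)
  then obtain i :: nat where "c = a [^] i" by (auto simp: A_eq)
  then have "g = a [^] i \<otimes> w [^] j" using g by (simp add: c_def inv_solve_right')
  then show ?thesis by (rule that)
qed

lemma coprime_alpha: "coprime (int n) \<alpha>"
proof -
  have pos: "ord a > 0" using ord_ge_1[OF finite_carrier a] by simp
  have "a [^] ord a = a [^] (0::nat)" by simp
  then have "[\<alpha> ^ ord a = 1] (mod (int n))" unfolding a_pow_eq_iff by simp
  then have "coprime (\<alpha> ^ ord a) (int n)" by (metis cong_imp_coprime cong_sym coprime_1_left)
  then show ?thesis using pos by (simp add: coprime_commute)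
qed

lemma order_quotient:
  assumes S: "subgroup S G" and "p > 0"
    and mem: "\<And>i::int. w [^] i \<in> S \<longleftrightarrow> int p dvd i"
  shows "order (G\<lparr>carrier := generate G {w}\<rparr> Mod S) = p"
proof -
  have "carrier (G\<lparr>carrier := generate G {w}\<rparr> Mod S) = range (\<lambda>i::int. S #> w [^] i)"
    by (auto simp: FactGroup_def RCOSETS_def r_coset_def W_eq)
  also have "card \<dots> = p"
    using \<open>p > 0\<close>
  proof (rule card_range_cong)
    show "S #> w [^] i = S #> w [^] j \<longleftrightarrow> int p dvd i - j" for i j :: int
      using S by (simp add: subgroup_rcos_eq_iff flip: int_pow_diff mem)
  qed
  finally show ?thesis by (simp add: order_def)
qed

end

section \<open>Commutators with \<open>b\<close> and the largest perfect subgroup\<close>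

context cyclic_regular_action
begin

lemma generate_w_pow: "generate G {w [^] (d::int)} = range (\<lambda>i::int. w [^] (d * i))"
  by (auto simp: generate_pow int_pow_pow)

lemma subgroup_w_pow: "subgroup (generate G {w [^] (d::int)}) G"
  by (simp add: generate_is_subgroup)

context
  fixes b :: 'g and \<beta> :: int
  assumes b: "b \<in> carrier G" and conj_b: "inv b \<otimes> w \<otimes> b = w [^] \<beta>"
begin

lemma commutator_w_pow: "inv b \<otimes> inv (w [^] (i::int)) \<otimes> b \<otimes> w [^] i = w [^] ((1 - \<beta>) * i)"
proof -
  have "inv b \<otimes> inv (w [^] i) \<otimes> b = w [^] (\<beta> * (- i))"
    using conj_int_pow[OF b w, of "- i"] by (simp add: conj_b int_pow_pow int_pow_neg)
  then show ?thesis by (simp add: w_pow_mult algebra_simps)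
qed

text \<open>On exponents, taking commutators with \<open>b\<close> is multiplication by
  \<open>1 - \<beta>\<close>, a homomorphism. The commutators therefore form a subgroup already, and
  generation adds nothing.\<close>

lemma commutator_with_subgroup:
  assumes U: "subgroup U G" "U \<subseteq> generate G {w}"
  shows "commutator_with G b U = {w [^] ((1 - \<beta>) * i) | i::int. w [^] i \<in> U}"
proof -
  interpret U: subgroup U G by (rule U)
  let ?S = "{w [^] ((1 - \<beta>) * i) | i::int. w [^] i \<in> U}"
  have "{inv b \<otimes> inv u \<otimes> b \<otimes> u | u. u \<in> U} = ?S"
  proof (intro equalityI subsetI)
    fix z assume "z \<in> {inv b \<otimes> inv u \<otimes> b \<otimes> u | u. u \<in> U}"
    then obtain u where u: "u \<in> U" "z = inv b \<otimes> inv u \<otimes> b \<otimes> u" by blast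
    moreover obtain i :: int where "u = w [^] i" using u U(2) by (auto simp: W_eq)
    ultimately show "z \<in> ?S" using commutator_w_pow by auto
  next
    fix z assume "z \<in> ?S"
    then show "z \<in> {inv b \<otimes> inv u \<otimes> b \<otimes> u | u. u \<in> U}" using commutator_w_pow by (auto; metis)
  qed
  moreover have "subgroup ?S G"
  proof
    show "?S \<subseteq> carrier G" by auto
    show "\<one> \<in> ?S" using U.one_closed by (intro CollectI exI[of _ 0]) simp
  next
    fix u v assume "u \<in> ?S" "v \<in> ?S"
    then obtain i j :: int where ij: "u = w [^] ((1 - \<beta>) * i)" "v = w [^] ((1 - \<beta>) * j)" "w [^] i \<in> U" "w [^] j \<in> U"
      by blast
    moreover have "w [^] (i + j) \<in> U" using U.m_closed[OF ij(3,4)] by (simp add: w_pow_mult)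
    ultimately show "u \<otimes> v \<in> ?S"
      by (intro CollectI exI[of _ "i + j"]) (simp add: w_pow_mult distrib_left)
  next
    fix u assume "u \<in> ?S"
    then obtain i :: int where i: "u = w [^] ((1 - \<beta>) * i)" "w [^] i \<in> U" by blast
    have "w [^] (- i) \<in> U" using U.m_inv_closed[OF i(2)] by (simp add: int_pow_neg)
    then show "inv u \<in> ?S" using i(1)
      by (intro CollectI exI[of _ "- i"]) (simp flip: int_pow_neg)
  qed
  ultimately show ?thesis unfolding commutator_with_def by (simp add: generate_subgroup)
qed

lemma commutator_with_W: "commutator_with G b (generate G {w}) = generate G {w [^] (1 - \<beta>)}"
proof -
  have "commutator_with G b (generate G {w}) = {w [^] ((1 - \<beta>) * i) | i::int. w [^] i \<in> generate G {w}}"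
    by (rule commutator_with_subgroup) (simp_all add: generate_is_subgroup)
  then show ?thesis by (auto simp: generate_w_pow W_eq)
qed

text \<open>Multiplication by \<open>1 - \<beta>\<close> is invertible modulo \<open>n1\<close> and
  nilpotent modulo \<open>n2\<close>. So the part of order \<open>n1\<close> is perfect, and
  iterating the commutator map pushes every perfect subgroup into it.\<close>

lemma largest_perfect_eq:
  assumes n12: "n = n1 * n2" and coprime: "coprime (int n1) (\<beta> - 1)"
    and primes: "\<And>r. \<lbrakk>Factorial_Ring.prime r; r dvd n2\<rbrakk> \<Longrightarrow> int r dvd \<beta> - 1"
  shows "largest_perfect G b (generate G {w}) = generate G {w [^] int n2}"
    (is "_ = ?V")
  unfolding largest_perfect_def
proof (rule Greatest_equality)
  have sub: "?V \<subseteq> generate G {w}" by (auto simp: generate_w_pow W_eq)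
  have mem: "w [^] i \<in> ?V \<longleftrightarrow> int n2 dvd i" for i :: int
  proof
    assume "w [^] i \<in> ?V"
    then obtain j :: int where "[i = int n2 * j] (mod (int n))" by (auto simp: generate_w_pow w_pow_eq_iff)
    then have "[i = int n2 * j] (mod (int n2))" by (rule cong_dvd_modulus) (simp add: n12)
    then show "int n2 dvd i" by (simp add: cong_dvd_iff)
  qed (auto simp: generate_w_pow elim!: dvdE)
  have V: "commutator_with G b ?V = {w [^] ((1 - \<beta>) * i) | i::int. int n2 dvd i}"
    using commutator_with_subgroup[OF subgroup_w_pow sub] by (simp only: mem)
  have "commutator_with G b ?V = ?V"
  proof (intro equalityI subsetI)
    fix z assume "z \<in> commutator_with G b ?V"
    then show "z \<in> ?V" unfolding V by (auto simp: mem)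
  next
    fix z assume "z \<in> ?V"
    then obtain j :: int where j: "z = w [^] (int n2 * j)" by (auto simp: generate_w_pow)
    \<comment> \<open>The inverse \<open>s\<close> of \<open>1 - \<beta>\<close> modulo
      \<open>n1\<close> exhibits each element of the part of order \<open>n1\<close> as a
      commutator.\<close>
    have "coprime (1 - \<beta>) (int n1)"
      using coprime by (metis coprime_commute coprime_minus_left_iff minus_diff_eq)
    then obtain s where "[(1 - \<beta>) * s = 1] (mod (int n1))" using cong_solve_coprime_int by blast
    then have "[int n2 * ((1 - \<beta>) * s) = int n2 * 1] (mod (int n2 * int n1))"
      by (rule cong_cmult_leftI)
    then have "[int n2 * ((1 - \<beta>) * s) * j = int n2 * 1 * j] (mod (int n))"
      unfolding n12 of_nat_mult by (subst mult.commute[of "int n1"]) (rule cong_scalar_right)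
    then have "z = w [^] ((1 - \<beta>) * (int n2 * (s * j)))"
      unfolding j w_pow_eq_iff by (simp add: ac_simps cong_sym_eq)
    then show "z \<in> commutator_with G b ?V" unfolding V
      by (intro CollectI exI[of _ "int n2 * (s * j)"] conjI dvd_triv_left)
  qed
  with sub show "subgroup ?V G \<and> ?V \<subseteq> generate G {w} \<and> commutator_with G b ?V = ?V"
    using subgroup_w_pow by blast
  fix V' assume "subgroup V' G \<and> V' \<subseteq> generate G {w} \<and> commutator_with G b V' = V'"
  then have V': "subgroup V' G" "V' \<subseteq> generate G {w}" "commutator_with G b V' = V'" by blast+
  \<comment> \<open>The exponent \<open>n\<close> is a crude uniform bound for the exponents of all
    prime powers in \<open>n2\<close>.\<close>
  have power: "int n2 dvd (1 - \<beta>) ^ n"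
  proof (rule dvd_of_prime_powers_dvd)
    show "n2 > 0" using n_pos by (simp add: n12)
    fix r e m' assume r: "Factorial_Ring.prime r" "n2 = r ^ e * m'"
    show "int r ^ e dvd (1 - \<beta>) ^ n"
    proof (cases "e = 0")
      case False
      then have "r dvd n2" using r by (auto intro: dvd_mult2)
      then have "int r dvd 1 - \<beta>" using primes[OF r(1)] by (metis dvd_minus_iff minus_diff_eq)
      then have "int r ^ e dvd (1 - \<beta>) ^ e" by (rule dvd_power_same)
      also have "e \<le> n"
      proof -
        have "e < r ^ e" using prime_gt_1_nat[OF r(1)] by (simp add: power_gt_expt)
        also have "\<dots> \<le> n" using r(2) n_pos by (intro dvd_imp_le) (simp_all add: n12)
        finally show ?thesis by simp
      qed
      then have "(1 - \<beta>) ^ e dvd (1 - \<beta>) ^ n" by (rule le_imp_power_dvd)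
      finally show ?thesis .
    qed simp
  qed
  have iterated: "\<exists>i::int. z = w [^] ((1 - \<beta>) ^ k * i) \<and> w [^] i \<in> V'" if "z \<in> V'" for z k
    using that
  proof (induction k arbitrary: z)
    case 0
    then obtain i :: int where "z = w [^] i" using V'(2) by (auto simp: W_eq)
    with 0 show ?case by auto
  next
    case (Suc k)
    then obtain i :: int where i: "z = w [^] ((1 - \<beta>) ^ k * i)" "w [^] i \<in> V'" by blast
    then obtain j :: int where j: "w [^] i = w [^] ((1 - \<beta>) * j)" "w [^] j \<in> V'"
      using commutator_with_subgroup[OF V'(1,2)] V'(3) by auto
    have "z = (w [^] i) [^] ((1 - \<beta>) ^ k)" using i(1) by (simp add: int_pow_pow mult.commute)
    also have "\<dots> = w [^] ((1 - \<beta>) ^ Suc k * j)" unfolding j(1) by (simp add: int_pow_pow ac_simps)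
    finally show ?case using j(2) by blast
  qed
  show "V' \<le> ?V"
  proof
    fix z assume "z \<in> V'"
    then obtain i :: int where "z = w [^] ((1 - \<beta>) ^ n * i)" using iterated by blast
    then show "z \<in> ?V" using power by (simp add: mem)
  qed
qed

end

end

section \<open>Subgroups in the normal form\<close>

locale normal_form_subgroup = cyclic_regular_action G \<Omega> \<phi> \<omega> w a \<alpha>
  for G :: "('g, 'm) monoid_scheme" (structure) and \<Omega> :: "'p set" and \<phi> \<omega> w a \<alpha> +
  fixes H :: "'g set" and b x y :: 'g and B :: nat and \<xi> \<eta> \<beta> :: int
  assumes subgroup_H: "subgroup H G"
    and normal_form: "normal_form G (generate G {a}) (generate G {w}) H b x y"
    and b_eq: "b = a [^] B" and x_eq: "x = w [^] \<xi>" and y_eq: "y = w [^] \<eta>"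
    and conj_b: "inv b \<otimes> w \<otimes> b = w [^] \<beta>"
begin

lemma b [simp]: "b \<in> carrier G" and x [simp]: "x \<in> carrier G" and y [simp]: "y \<in> carrier G"
  by (simp_all add: b_eq x_eq y_eq)

lemma beta: "[\<beta> = \<alpha> ^ B] (mod (int n))"
proof -
  have "b \<otimes> w [^] \<beta> = w [^] (1::int) \<otimes> b"
    using int_pow_conj_swap[OF b w conj_b, of 1 1] by simp
  also have "\<dots> = b \<otimes> w [^] (\<alpha> ^ B)"
    using w_swap[of 1 B] by (simp add: b_eq)
  finally show ?thesis by (simp add: w_pow_eq_iff)
qed

text \<open>Since the powers of \<open>y\<close> are the translations by multiples of
  \<open>\<eta>\<close> modulo \<open>n\<close>, this gcd is the order of the quotient of
  \<open>W\<close> by its intersection with \<open>H\<close>.\<close>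

definition m :: nat where "m = nat (gcd (int n) \<eta>)"

lemma int_m: "int m = gcd (int n) \<eta>"
  by (simp add: m_def)

lemma m_dvd_n: "m dvd n"
  using int_m by (metis gcd_dvd1 int_dvd_int_iff)

lemma m_pos: "m > 0"
  using m_dvd_n n_pos by (auto intro: Nat.gr0I)

lemma m_dvd_iff: "int m dvd z \<longleftrightarrow> (\<exists>t. [z = \<eta> * t] (mod (int n)))"
proof
  assume "int m dvd z"
  then obtain q where q: "z = int m * q" by (elim dvdE)
  obtain u v where "u * int n + v * \<eta> = int m" using bezout_int[of "int n" \<eta>] unfolding int_m by blast
  then have "z = \<eta> * (v * q) + int n * (u * q)" unfolding q by (simp add: algebra_simps flip: \<open>_ = int m\<close>)
  then have "[z = \<eta> * (v * q)] (mod (int n))" by (simp add: cong_iff_dvd_diff)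
  then show "\<exists>t. [z = \<eta> * t] (mod (int n))" ..
next
  assume "\<exists>t. [z = \<eta> * t] (mod (int n))"
  then obtain t where t: "[z = \<eta> * t] (mod (int n))" ..
  have mn: "int m dvd int n" using m_dvd_n by simp
  have "int m dvd \<eta>" by (simp add: int_m)
  with cong_dvd_modulus[OF t mn] show "int m dvd z" by (simp add: cong_dvd_iff)
qed

lemma H_Int_W: "H \<inter> generate G {w} = generate G {w [^] \<eta>}"
  using normal_form by (simp add: normal_form_def y_eq)

lemma w_pow_mem_iff: "w [^] z \<in> H \<inter> generate G {w} \<longleftrightarrow> int m dvd z" for z :: int
  by (auto simp: H_Int_W generate_w_pow w_pow_eq_iff m_dvd_iff)

lemma b_pow: "b [^] (k::nat) = a [^] (B * k)"
  by (simp add: b_eq nat_pow_pow)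

lemma bx_pow: "(b \<otimes> x) [^] (k::nat) = a [^] (B * k) \<otimes> w [^] (\<xi> * geom \<beta> k)"
proof (induction k)
  case (Suc k)
  have "(b \<otimes> x) [^] Suc k = (b \<otimes> x) \<otimes> (b \<otimes> x) [^] k" by (simp only: b x m_closed nat_pow_Suc2)
  also have "\<dots> = b \<otimes> (w [^] \<xi> \<otimes> b [^] k) \<otimes> w [^] (\<xi> * geom \<beta> k)"
    unfolding Suc unfolding x_eq b_pow[symmetric] by (simp add: m_assoc)
  also have "w [^] \<xi> \<otimes> b [^] k = b [^] k \<otimes> w [^] (\<beta> ^ k * \<xi>)"
    by (rule int_pow_conj_swap) (simp_all add: conj_b)
  also have "b \<otimes> (b [^] k \<otimes> w [^] (\<beta> ^ k * \<xi>)) \<otimes> w [^] (\<xi> * geom \<beta> k) =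
      b \<otimes> b [^] k \<otimes> (w [^] (\<beta> ^ k * \<xi>) \<otimes> w [^] (\<xi> * geom \<beta> k))"
    by (simp add: m_assoc)
  also have "b \<otimes> b [^] k = b [^] Suc k" by (simp only: b nat_pow_Suc2)
  also have "w [^] (\<beta> ^ k * \<xi>) \<otimes> w [^] (\<xi> * geom \<beta> k) = w [^] (\<xi> * geom \<beta> (Suc k))"
    by (simp add: w_pow_mult geom_Suc algebra_simps)
  finally show ?case by (simp only: b_pow)
qed simp

lemma y_swap: "y [^] (t::int) \<otimes> (b \<otimes> x) [^] (k::nat) = (b \<otimes> x) [^] k \<otimes> y [^] (\<beta> ^ k * t)"
proof (rule int_pow_conj_swap)
  have "inv (b \<otimes> x) \<otimes> y \<otimes> (b \<otimes> x) = inv x \<otimes> (inv b \<otimes> w [^] \<eta> \<otimes> b) \<otimes> x"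
    by (simp add: inv_mult_group m_assoc y_eq)
  also have "inv b \<otimes> w [^] \<eta> \<otimes> b = w [^] (\<beta> * \<eta>)"
    by (simp add: conj_int_pow conj_b int_pow_pow)
  also have "inv x \<otimes> w [^] (\<beta> * \<eta>) \<otimes> x = y [^] \<beta>"
    by (simp add: x_eq y_eq w_pow_mult int_pow_pow mult.commute flip: int_pow_neg)
  finally show "inv (b \<otimes> x) \<otimes> y \<otimes> (b \<otimes> x) = y [^] \<beta>" .
qed simp_all

text \<open>\<open>y_swap\<close> collects powers of \<open>b \<otimes> x\<close> on the left and
  powers of \<open>y\<close> on the right, so such products are closed under multiplication.\<close>

lemma mem_H_iff: "g \<in> H \<longleftrightarrow> (\<exists>(k::nat) t. g = a [^] (B * k) \<otimes> w [^] (\<xi> * geom \<beta> k + \<eta> * t))"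
proof -
  have form: "a [^] (B * k) \<otimes> w [^] (\<xi> * geom \<beta> k + \<eta> * t) = (b \<otimes> x) [^] k \<otimes> y [^] t" for k t
    by (simp add: bx_pow y_eq int_pow_pow m_assoc w_pow_mult)
  have H: "H = generate G {b \<otimes> x, y}" using normal_form by (simp add: normal_form_def)
  have bx: "b \<otimes> x \<in> H" "y \<in> H" unfolding H by (auto intro: generate.incl)
  interpret H: subgroup H G by (rule subgroup_H)
  have "\<exists>(k::nat) (t::int). g = (b \<otimes> x) [^] k \<otimes> y [^] t" if "g \<in> generate G {b \<otimes> x, y}"
    using that
  proof (induction g rule: generate.induct)
    case one
    show ?case by (intro exI[of _ 0]) simp
  next
    case (incl h)
    then consider "h = b \<otimes> x" | "h = y" by blast
    then show ?case
    proof cases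
      case 1
      then show ?thesis by (intro exI[of _ 1] exI[of _ 0]) simp
    next
      case 2
      then show ?thesis by (intro exI[of _ 0] exI[of _ 1]) simp
    qed
  next
    case (inv h)
    then consider "h = b \<otimes> x" | "h = y" by blast
    then show ?case
    proof cases
      case 1
      \<comment> \<open>By finiteness the inverse is a natural power, so \<open>k\<close> never has
        to be negative.\<close>
      let ?N = "ord (b \<otimes> x)"
      have "?N \<ge> 1" using ord_ge_1[OF finite_carrier] by simp
      then have "(b \<otimes> x) [^] (?N - 1) \<otimes> (b \<otimes> x) = \<one>"
        using nat_pow_Suc[of "b \<otimes> x" "?N - 1"] pow_ord_eq_1[of "b \<otimes> x"] by simp
      then have "inv (b \<otimes> x) = (b \<otimes> x) [^] (?N - 1)" by (rule inv_equality) simp_all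
      with 1 show ?thesis by (intro exI[of _ "?N - 1"] exI[of _ 0]) simp
    next
      case 2
      then show ?thesis by (intro exI[of _ 0] exI[of _ "-1"]) (simp add: int_pow_neg)
    qed
  next
    case (eng h1 h2)
    then obtain k1 t1 k2 t2 where h: "h1 = (b \<otimes> x) [^] (k1::nat) \<otimes> y [^] (t1::int)"
      "h2 = (b \<otimes> x) [^] (k2::nat) \<otimes> y [^] (t2::int)" by blast
    have "h1 \<otimes> h2 = (b \<otimes> x) [^] k1 \<otimes> (y [^] t1 \<otimes> (b \<otimes> x) [^] k2) \<otimes> y [^] t2"
      by (simp add: h m_assoc)
    also have "\<dots> = (b \<otimes> x) [^] (k1 + k2) \<otimes> y [^] (\<beta> ^ k2 * t1 + t2)"
      unfolding y_swap by (simp add: m_assoc int_pow_mult flip: nat_pow_mult)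
    finally show ?case by blast
  qed
  moreover have "(b \<otimes> x) [^] (k::nat) \<otimes> y [^] (t::int) \<in> H" for k t
  proof -
    have "(b \<otimes> x) [^] int k \<in> H" "y [^] t \<in> H"
      using bx subgroup_int_pow_closed[OF subgroup_H] by blast+
    then show ?thesis by (simp add: int_pow_int)
  qed
  ultimately show ?thesis unfolding form using H by blast
qed

section \<open>Relative closedness expressed by congruences\<close>

lemma element_mem_H_iff:
  "a [^] (i::nat) \<otimes> w [^] (j::int) \<in> H \<longleftrightarrow>
    (\<exists>k. [\<alpha> ^ i = \<beta> ^ k] (mod (int n)) \<and> [j = \<xi> * geom \<beta> k] (mod (int m)))"
proof -
  have "[\<alpha> ^ (B * k) = \<beta> ^ k] (mod (int n))" for k
    unfolding power_mult using cong_sym[OF beta] by (rule cong_pow)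
  then have A: "[\<alpha> ^ i = \<alpha> ^ (B * k)] (mod (int n)) \<longleftrightarrow> [\<alpha> ^ i = \<beta> ^ k] (mod (int n))" for k
    by (metis cong_sym cong_trans)
  have B: "(\<exists>t. [j = \<xi> * geom \<beta> k + \<eta> * t] (mod (int n))) \<longleftrightarrow> [j = \<xi> * geom \<beta> k] (mod (int m))" for k
    unfolding cong_iff_dvd_diff[of j _ "int m"] m_dvd_iff by (simp add: cong_iff_dvd_diff algebra_simps)
  show ?thesis unfolding mem_H_iff element_eq_iff A B[symmetric] by blast
qed

text \<open>The multiples of \<open>\<eta>\<close> contributed by \<open>y\<close> sweep out all
  multiples of \<open>m\<close> modulo \<open>n\<close>, so an orbit of \<open>H\<close> is the
  preimage of a set of iterates modulo \<open>m\<close>.\<close>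

lemma act_mem_orbit_iff:
  "\<phi> (inv (a [^] (i::nat) \<otimes> w [^] (j::int))) (point u) \<in> orbit (G\<lparr>carrier := H\<rparr>) \<phi> (point u) \<longleftrightarrow>
    (\<exists>k. [\<alpha> ^ i * u + j = \<beta> ^ k * u + \<xi> * geom \<beta> k] (mod (int m)))"
proof -
  interpret H: subgroup H G by (rule subgroup_H)
  let ?h = "\<lambda>k t. a [^] (B * k) \<otimes> w [^] (\<xi> * geom \<beta> k + \<eta> * t)"
  have "p \<in> orbit (G\<lparr>carrier := H\<rparr>) \<phi> (point u) \<longleftrightarrow> (\<exists>k t. p = \<phi> (inv (?h k t)) (point u))" for p
  proof
    assume "p \<in> orbit (G\<lparr>carrier := H\<rparr>) \<phi> (point u)"
    then obtain h where h: "h \<in> H" "p = \<phi> h (point u)" by (auto simp: orbit_def)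
    then obtain k t where "inv h = ?h k t" using H.m_inv_closed mem_H_iff by blast
    then have "h = inv (?h k t)" using h(1) by (metis inv_inv H.mem_carrier)
    with h(2) show "\<exists>k t. p = \<phi> (inv (?h k t)) (point u)" by blast
  next
    assume "\<exists>k t. p = \<phi> (inv (?h k t)) (point u)"
    then obtain k t where "p = \<phi> (inv (?h k t)) (point u)" by blast
    moreover have "inv (?h k t) \<in> H" using mem_H_iff by (intro H.m_inv_closed) blast
    ultimately show "p \<in> orbit (G\<lparr>carrier := H\<rparr>) \<phi> (point u)" by (auto simp: orbit_def)
  qed
  moreover have "[\<alpha> ^ (B * k) * u + c = \<beta> ^ k * u + c] (mod (int n))" for k c
    unfolding power_mult using cong_sym[OF beta] by (intro cong_add cong_refl cong_pow cong_scalar_right)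
  then have "[z = \<alpha> ^ (B * k) * u + c] (mod (int n)) \<longleftrightarrow> [z = \<beta> ^ k * u + c] (mod (int n))" for z c k
    by (metis cong_sym cong_trans)
  moreover have "(\<exists>t. [z = \<beta> ^ k * u + (\<xi> * geom \<beta> k + \<eta> * t)] (mod (int n))) \<longleftrightarrow>
      [z = \<beta> ^ k * u + \<xi> * geom \<beta> k] (mod (int m))" for z k
    unfolding cong_iff_dvd_diff[of z _ "int m"] m_dvd_iff by (simp add: cong_iff_dvd_diff algebra_simps)
  ultimately show ?thesis by (simp add: act_point point_eq_iff)
qed

lemma relatively_closed_iff_cong:
  "relatively_closed G \<Omega> \<phi> H \<longleftrightarrow>
    (\<forall>(i::nat) (j::int). (\<forall>u. \<exists>k. [\<alpha> ^ i * u + j = \<beta> ^ k * u + \<xi> * geom \<beta> k] (mod (int m))) \<longrightarrow>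
        (\<exists>k. [\<alpha> ^ i = \<beta> ^ k] (mod (int n)) \<and> [j = \<xi> * geom \<beta> k] (mod (int m))))"
proof -
  interpret H: subgroup H G by (rule subgroup_H)
  have orb: "(\<forall>q\<in>\<Omega>. \<phi> g q \<in> orbit (G\<lparr>carrier := H\<rparr>) \<phi> q) \<longleftrightarrow>
      (\<forall>u. \<phi> g (point u) \<in> orbit (G\<lparr>carrier := H\<rparr>) \<phi> (point u))" for g
    using point_in point_surj by metis
  \<comment> \<open>All elements are inverted, to match the form of
    \<open>act_mem_orbit_iff\<close>; \<open>H\<close> is closed under inverses.\<close>
  have "relatively_closed G \<Omega> \<phi> H \<longleftrightarrow>
      (\<forall>g\<in>carrier G. (\<forall>q\<in>\<Omega>. \<phi> (inv g) q \<in> orbit (G\<lparr>carrier := H\<rparr>) \<phi> q) \<longrightarrow> g \<in> H)"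
    unfolding relatively_closed_iff[OF subgroup_H] by (metis inv_closed inv_inv H.m_inv_closed)
  also have "\<dots> \<longleftrightarrow> (\<forall>(i::nat) (j::int).
      (\<forall>u. \<phi> (inv (a [^] i \<otimes> w [^] j)) (point u) \<in> orbit (G\<lparr>carrier := H\<rparr>) \<phi> (point u)) \<longrightarrow>
      a [^] i \<otimes> w [^] j \<in> H)"
    unfolding orb using element_decomposition by (metis a w int_pow_closed m_closed nat_pow_closed)
  finally show ?thesis by (simp only: act_mem_orbit_iff element_mem_H_iff)
qed

text \<open>When \<open>\<beta> ^ k\<close> is trivial, the \<open>k\<close>-th power of
  \<open>b \<otimes> x\<close> is a translation, hence lies in the intersection of \<open>H\<close>
  and \<open>W\<close>.\<close>

lemma trivial_translations:
  assumes "[\<beta> ^ k = 1] (mod (int n))"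
  shows "int m dvd \<xi> * geom \<beta> k"
proof -
  have "\<exists>k'. [\<alpha> ^ 0 = \<beta> ^ k'] (mod (int n)) \<and> [\<xi> * geom \<beta> k = \<xi> * geom \<beta> k'] (mod (int m))"
    using assms by (intro exI[of _ k]) (simp add: cong_sym_eq)
  then have "a [^] (0::nat) \<otimes> w [^] (\<xi> * geom \<beta> k) \<in> H" unfolding element_mem_H_iff .
  then show ?thesis by (simp add: W_eq flip: w_pow_mem_iff)
qed

text \<open>Let \<open>f\<close> and \<open>d\<close> be the exponents of \<open>r\<close> in
  \<open>n\<close> and \<open>\<xi>\<close>. The order of \<open>x\<close> has exponent at most
  \<open>f - d\<close> at \<open>r\<close>, so the normal form bounds the exponent \<open>h\<close>
  in the order of the commutator group by \<open>h < f - d\<close>. As \<open>r ^ (f - h)\<close>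
  divides \<open>\<beta> - 1\<close>, the latter has exponent greater than \<open>d\<close>.\<close>

lemma normal_form_dvd:
  assumes r: "Factorial_Ring.prime r" and "r ^ e dvd m" "\<not> int r ^ e dvd \<xi>" "int r ^ c dvd \<xi>"
  shows "int r ^ Suc c dvd \<beta> - 1"
proof -
  have "\<xi> \<noteq> 0" using assms(3) by auto
  then obtain d \<xi>' where xi: "\<xi> = int r ^ d * \<xi>'" "\<not> int r dvd \<xi>'"
    using prime_power_split_int r by blast
  obtain f n' where n: "n = r ^ f * n'" "\<not> r dvd n'" using prime_power_split r n_pos by blast
  have r0: "r \<noteq> 0" "r > 1" using prime_gt_0_nat[OF r] prime_gt_1_nat[OF r] by auto
  have cop: "coprime (int r ^ k) \<xi>'" "coprime (r ^ k) n'" for k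
    using xi(2) n(2) r by (simp_all add: prime_imp_coprime)
  have "c \<le> d"
  proof -
    have "int r ^ c dvd int r ^ d" using assms(4) cop(1)[of c] by (simp add: xi(1) coprime_dvd_mult_left_iff)
    then have "r ^ c dvd r ^ d" by (metis of_nat_dvd_iff of_nat_power)
    then show ?thesis using r0(2) by (rule power_dvd_imp_le)
  qed
  have "d < e"
  proof (rule ccontr)
    assume "\<not> d < e"
    then have "int r ^ e dvd int r ^ d" by (intro le_imp_power_dvd) simp
    then show False using assms(3) by (simp add: xi(1))
  qed
  have "e \<le> f"
  proof -
    have "r ^ e dvd r ^ f * n'" using dvd_trans[OF assms(2) m_dvd_n] by (simp add: n(1))
    then have "r ^ e dvd r ^ f" using cop(2)[of e] by (simp add: coprime_dvd_mult_left_iff)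
    then show ?thesis using r0(2) by (rule power_dvd_imp_le)
  qed
  have int_n: "int n = int r ^ f * int n'" by (simp add: n(1))
  then have rn: "int r ^ f dvd int n" by simp
  \<comment> \<open>The orders of \<open>x\<close> and of the commutator group are accessed only
    through their multiples.\<close>
  have ord_dvd: "int (ord (w [^] z)) dvd t \<longleftrightarrow> int n dvd z * t" for z t :: int
  proof -
    have "int (ord (w [^] z)) dvd t \<longleftrightarrow> w [^] (z * t) = \<one>"
      using int_pow_eq_id[of "w [^] z" t] by (simp add: int_pow_pow)
    then show ?thesis by (simp add: int_pow_eq_id n_def)
  qed
  define o1 where "o1 = ord x"
  define o2 where "o2 = card (commutator_with G b (generate G {w}))"
  have o1_dvd: "int o1 dvd t \<longleftrightarrow> int n dvd \<xi> * t" for t by (simp add: o1_def x_eq ord_dvd)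
  have "o2 = ord (w [^] (1 - \<beta>))"
    by (simp add: o2_def commutator_with_W[OF b conj_b] generate_pow_card)
  then have o2_dvd: "int o2 dvd t \<longleftrightarrow> int n dvd (1 - \<beta>) * t" for t by (simp add: ord_dvd)
  have o1_pos: "o1 > 0" using ord_ge_1[OF finite_carrier x] by (simp add: o1_def)
  have "o1 dvd r ^ (f - d) * n'"
  proof -
    have "int n dvd \<xi> * (int r ^ (f - d) * int n')"
      using \<open>d < e\<close> \<open>e \<le> f\<close> unfolding int_n xi(1)
      by (metis (no_types, lifting) dvd_triv_right le_add_diff_inverse less_imp_le_nat mult.assoc
          mult.commute order_less_le_trans power_add)
    then have "int o1 dvd int (r ^ (f - d) * n')" by (simp add: o1_dvd)
    then show ?thesis by (simp only: of_nat_dvd_iff)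
  qed
  moreover have n'0: "n' \<noteq> 0" using n(2) by (metis dvd_0_right)
  moreover have "multiplicity r (r ^ (f - d) * n') = f - d"
    using n(2) r0 by (intro multiplicity_eqI) auto
  ultimately have mult_o1: "multiplicity r o1 \<le> f - d"
    using dvd_imp_multiplicity_le[of o1 "r ^ (f - d) * n'" r] r0 by simp
  \<comment> \<open>The normal form speaks only of primes dividing the order of \<open>x\<close>;
    \<open>d < e \<le> f\<close> guarantees that \<open>r\<close> is one of them.\<close>
  have "r dvd o1"
  proof -
    have "int n dvd \<xi> * int o1" using o1_dvd[of "int o1"] by simp
    with rn have "int r ^ f dvd \<xi> * int o1" by (rule dvd_trans)
    then have "int r ^ d * int r ^ (f - d) dvd int r ^ d * (\<xi>' * int o1)"
      using \<open>d < e\<close> \<open>e \<le> f\<close> by (simp add: xi(1) mult.assoc flip: power_add)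
    then have "int r ^ (f - d) dvd \<xi>' * int o1" using r0 by simp
    then have "int r ^ (f - d) dvd int o1" using coprime_dvd_mult_right_iff[OF cop(1)] by blast
    moreover have "int r dvd int r ^ (f - d)" using \<open>d < e\<close> \<open>e \<le> f\<close> by (intro dvd_power) simp
    ultimately have "int r dvd int o1" by (rule dvd_trans[rotated])
    then show ?thesis by simp
  qed
  then have "r \<in> prime_factors o1" using r o1_pos by (simp add: prime_factors_dvd)
  then have "prime_part r o2 < prime_part r o1"
    using normal_form by (simp add: normal_form_def o1_def o2_def)
  then have "multiplicity r o2 < multiplicity r o1"
    using r0 by (simp add: prime_part_def)
  with mult_o1 have mult_o2: "multiplicity r o2 < f - d" by simp
  have o2_pos: "o2 > 0"
    using \<open>o2 = ord (w [^] (1 - \<beta>))\<close> ord_ge_1[OF finite_carrier, of "w [^] (1 - \<beta>)"] by simp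
  obtain h o2' where o2: "o2 = r ^ h * o2'" "\<not> r dvd o2'" using prime_power_split r o2_pos by blast
  have "multiplicity r o2 = h" using o2 r0 by (intro multiplicity_eqI) auto
  with mult_o2 have "h < f - d" by simp
  have "int n dvd (1 - \<beta>) * int o2" using o2_dvd[of "int o2"] by simp
  with rn have "int r ^ f dvd (1 - \<beta>) * int o2" by (rule dvd_trans)
  then have "int r ^ f dvd ((1 - \<beta>) * int r ^ h) * int o2'" by (simp add: o2(1) mult.assoc)
  moreover have "coprime (int r ^ f) (int o2')" using o2(2) r by (simp add: prime_imp_coprime)
  ultimately have "int r ^ f dvd (1 - \<beta>) * int r ^ h" by (simp add: coprime_dvd_mult_left_iff)
  then have "int r ^ h * int r ^ (f - h) dvd int r ^ h * (1 - \<beta>)"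
    using \<open>h < f - d\<close> by (simp add: mult.commute flip: power_add)
  then have "int r ^ (f - h) dvd 1 - \<beta>" using r0 by simp
  then have "int r ^ (f - h) dvd \<beta> - 1" by (metis dvd_minus_iff minus_diff_eq)
  moreover have "int r ^ Suc c dvd int r ^ (f - h)"
    using \<open>h < f - d\<close> \<open>c \<le> d\<close> by (intro le_imp_power_dvd) simp
  ultimately show ?thesis by (rule dvd_trans[rotated])
qed

lemma b_mem_iff: "a [^] (i::nat) \<in> generate G {b} \<longleftrightarrow> (\<exists>k. [\<alpha> ^ i = \<beta> ^ k] (mod (int n)))"
proof -
  have "[\<alpha> ^ (B * k) = \<beta> ^ k] (mod (int n))" for k
    unfolding power_mult using cong_sym[OF beta] by (rule cong_pow)
  then have A: "[\<alpha> ^ i = \<alpha> ^ (B * k)] (mod (int n)) \<longleftrightarrow> [\<alpha> ^ i = \<beta> ^ k] (mod (int n))" for k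
    by (metis cong_sym cong_trans)
  have "a [^] i \<in> generate G {b} \<longleftrightarrow> (\<exists>k::nat. a [^] i = a [^] (B * k))"
    by (auto simp: generate_pow_on_finite_carrier[OF finite_carrier] b_pow)
  then show ?thesis by (simp only: a_pow_eq_iff A)
qed

lemma x_pow_mem_iff: "x [^] z \<in> H \<inter> generate G {w} \<longleftrightarrow> int m dvd \<xi> * z" for z :: int
  by (simp only: x_eq int_pow_pow[OF w] w_pow_mem_iff)

text \<open>In the quotient, cyclic of order \<open>m\<close>, the image of \<open>V\<close>
  consists of the multiples of \<open>n2\<close>.\<close>

lemma card_image_largest_perfect:
  assumes "n = n1 * n2" "coprime (int n1) (\<beta> - 1)"
    and "\<And>r. \<lbrakk>Factorial_Ring.prime r; r dvd n2\<rbrakk> \<Longrightarrow> int r dvd \<beta> - 1"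
  shows "card ((\<lambda>v. (H \<inter> generate G {w}) #> v) ` largest_perfect G b (generate G {w})) = m div gcd m n2"
proof -
  have sub: "subgroup (H \<inter> generate G {w}) G" unfolding H_Int_W by (rule subgroup_w_pow)
  have "(\<lambda>v. (H \<inter> generate G {w}) #> v) ` largest_perfect G b (generate G {w}) =
      range (\<lambda>i::int. (H \<inter> generate G {w}) #> w [^] (int n2 * i))"
    by (simp add: largest_perfect_eq[OF b conj_b assms] generate_w_pow image_image)
  also have "card \<dots> = m div gcd m n2"
  proof (rule card_range_cong)
    have "gcd m n2 \<le> m" using m_pos by (intro dvd_imp_le) simp_all
    then show "m div gcd m n2 > 0" using m_pos by (simp add: div_greater_zero_iff)
    fix i j :: int
    have g: "m = gcd m n2 * (m div gcd m n2)" "n2 = gcd m n2 * (n2 div gcd m n2)" "gcd m n2 > 0" using m_pos by simp_all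
    have cop: "coprime (int (m div gcd m n2)) (int (n2 div gcd m n2))"
      using div_gcd_coprime[of m n2] m_pos by simp
    have "(H \<inter> generate G {w}) #> w [^] (int n2 * i) = (H \<inter> generate G {w}) #> w [^] (int n2 * j) \<longleftrightarrow>
        int m dvd int n2 * (i - j)"
      by (simp add: subgroup_rcos_eq_iff[OF sub] right_diff_distrib flip: int_pow_diff w_pow_mem_iff)
    also have "\<dots> \<longleftrightarrow> int (gcd m n2) * int (m div gcd m n2) dvd int (gcd m n2) * (int (n2 div gcd m n2) * (i - j))"
      using g(1,2) by (metis mult.assoc of_nat_mult)
    also have "\<dots> \<longleftrightarrow> int (m div gcd m n2) dvd int (n2 div gcd m n2) * (i - j)"
      using m_pos by (subst dvd_mult_cancel_left) simp
    also have "\<dots> \<longleftrightarrow> int (m div gcd m n2) dvd i - j"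
      using cop by (simp add: coprime_dvd_mult_right_iff)
    finally show "(H \<inter> generate G {w}) #> w [^] (int n2 * i) = (H \<inter> generate G {w}) #> w [^] (int n2 * j) \<longleftrightarrow>
        int (m div gcd m n2) dvd i - j" .
  qed
  finally show ?thesis .
qed

text \<open>The data of \<open>affine_map\<close> are instantiated with
  \<open>mU = gcd m n2\<close>, the part of \<open>m\<close> at the primes dividing
  \<open>\<beta> - 1\<close>. \<open>Pocklington.ord\<close> is the multiplicative order of
  integers; plain \<open>ord\<close> denotes the order of a group element here.\<close>

lemma relatively_closed_criterion:
  assumes nW: "nW = order (G\<lparr>carrier := generate G {w}\<rparr> Mod (H \<inter> generate G {w}))"
    and nV: "nV = card ((\<lambda>v. (H \<inter> generate G {w}) #> v) ` largest_perfect G b (generate G {w}))"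
    and l: "l = Pocklington.ord (int nV) \<beta>"
  shows "relatively_closed G \<Omega> \<phi> H \<longleftrightarrow>
    a [^] Pocklington.ord (int nW) \<alpha> \<in> generate G {b} \<and>
    (if 4 dvd nW \<and> [\<beta> = -1] (mod 4)
     then x [^] ((\<beta> + 1) * int l div int (gcd 2 l)) \<in> H \<inter> generate G {w}
     else x [^] l \<in> H \<inter> generate G {w})"
proof -
  have sub: "subgroup (H \<inter> generate G {w}) G" unfolding H_Int_W by (rule subgroup_w_pow)
  have nW: "nW = m" unfolding nW using sub m_pos w_pow_mem_iff by (rule order_quotient)
  obtain n1 n2 where n12: "n = n1 * n2" "coprime n1 n2" "coprime (int n1) (\<beta> - 1)"
    and n2: "\<And>r. \<lbrakk>Factorial_Ring.prime r; r dvd n2\<rbrakk> \<Longrightarrow> int r dvd \<beta> - 1"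
    using coprime_split[OF n_pos] by blast
  define mU where "mU = gcd m n2"
  have nV: "nV = m div mU" unfolding nV mU_def by (rule card_image_largest_perfect[OF n12(1,3) n2])
  have m_eq: "m = nV * mU" by (simp add: nV mU_def)
  \<comment> \<open>After cancelling \<open>mU\<close>, \<open>nV\<close> divides
    \<open>n1 * (n2 div mU)\<close> and is coprime to the second factor.\<close>
  have "nV dvd n1"
  proof -
    have "coprime nV (n2 div mU)" unfolding nV mU_def using m_pos by (intro div_gcd_coprime) simp
    moreover have "mU * (n2 div mU) = n2" by (simp add: mU_def)
    then have "mU * nV dvd mU * (n1 * (n2 div mU))"
      using m_dvd_n by (metis m_eq mult.commute mult.left_commute n12(1))
    then have "nV dvd n1 * (n2 div mU)" using m_pos m_eq by simp
    ultimately show ?thesis by (simp add: coprime_dvd_mult_left_iff)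
  qed
  interpret affine_map m nV mU l \<beta> \<xi>
  proof
    show "coprime nV mU"
      by (rule coprime_divisors[OF \<open>nV dvd n1\<close> _ n12(2)]) (simp add: mU_def)
    show "coprime (int nV) (\<beta> - 1)"
      using n12(3) \<open>nV dvd n1\<close> by (metis coprime_divisors dvd_refl of_nat_dvd_iff)
    show "int r dvd \<beta> - 1" if "Factorial_Ring.prime r" "r dvd mU" for r
      using that n2 by (simp add: mU_def)
    show "coprime (int m) \<beta>"
    proof -
      have "coprime (int n) (\<alpha> ^ B)" using coprime_alpha by simp
      then have "coprime (int n) \<beta>" using cong_imp_coprime[OF cong_sym[OF beta]] by (simp add: coprime_commute)
      then show ?thesis using m_dvd_n by (intro coprime_divisors[of "int m" "int n" \<beta> \<beta>]) simp_all
    qed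
  qed (use m_pos m_eq l normal_form_dvd in auto)
  have "relatively_closed G \<Omega> \<phi> H \<longleftrightarrow>
      (\<exists>k. [\<alpha> ^ Pocklington.ord (int m) \<alpha> = \<beta> ^ k] (mod (int n))) \<and> translation_part_trivial"
    unfolding relatively_closed_iff_cong
    using closed_iff[OF m_dvd_n n_pos coprime_alpha beta trivial_translations]
    unfolding iterate_def by blast
  moreover have "x [^] l \<in> H \<inter> generate G {w} \<longleftrightarrow> int m dvd \<xi> * int l"
    using x_pow_mem_iff[of "int l"] by (simp only: int_pow_int)
  ultimately show ?thesis
    unfolding nW b_mem_iff translation_part_trivial_def exceptional_def x_pow_mem_iff by argo
qed

end

theorem theorem6p4:
  fixes G :: "('g, 'm) monoid_scheme" and \<Omega> :: "'p set" and \<phi> :: "'g \<Rightarrow> 'p \<Rightarrow> 'p"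
    and \<omega> :: 'p and W A H V :: "'g set" and w a b x y :: 'g
    and \<alpha> \<beta> :: int and nW nV l :: nat
  assumes "faithful_action G \<Omega> \<phi>" and "finite (carrier G)"
    and "W \<lhd> G" and "regular_subgroup G \<Omega> \<phi> W"
    and "w \<in> carrier G" and "W = generate G {w}"
    and "\<omega> \<in> \<Omega>" and "A = stabilizer G \<phi> \<omega>"
    and "a \<in> carrier G" and "A = generate G {a}"
    and "inv\<^bsub>G\<^esub> a \<otimes>\<^bsub>G\<^esub> w \<otimes>\<^bsub>G\<^esub> a = w [^]\<^bsub>G\<^esub> \<alpha>"
    and "subgroup H G" and "normal_form G A W H b x y"
    and "inv\<^bsub>G\<^esub> b \<otimes>\<^bsub>G\<^esub> w \<otimes>\<^bsub>G\<^esub> b = w [^]\<^bsub>G\<^esub> \<beta>"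
    and "nW = order (G\<lparr>carrier := W\<rparr> Mod (H \<inter> W))"
    and "V = largest_perfect G b W"
    and "nV = card ((\<lambda>v. (H \<inter> W) #>\<^bsub>G\<^esub> v) ` V)"
    and "l = ord (int nV) \<beta>"
  shows "relatively_closed G \<Omega> \<phi> H \<longleftrightarrow>
    a [^]\<^bsub>G\<^esub> ord (int nW) \<alpha> \<in> generate G {b} \<and>
    (if 4 dvd nW \<and> [\<beta> = -1] (mod 4)
     then x [^]\<^bsub>G\<^esub> ((\<beta> + 1) * int l div int (gcd 2 l)) \<in> H \<inter> W
     else x [^]\<^bsub>G\<^esub> l \<in> H \<inter> W)"
proof -
  interpret faithful_action G \<Omega> \<phi> by (rule assms(1))
  have W: "W = generate G {w}" and A: "A = generate G {a}" by fact+
  interpret cyclic_regular_action G \<Omega> \<phi> \<omega> w a \<alpha>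
    by unfold_locales (use assms in auto)
  have mem: "b \<in> A" "x \<in> W" "y \<in> W" using assms(13) by (simp_all add: normal_form_def)
  obtain B :: nat where B: "b = a [^]\<^bsub>G\<^esub> B" using mem(1) unfolding A A_eq by blast
  obtain \<xi> \<eta> :: int where xy: "x = w [^]\<^bsub>G\<^esub> \<xi>" "y = w [^]\<^bsub>G\<^esub> \<eta>" using mem(2,3) unfolding W W_eq by blast
  interpret normal_form_subgroup G \<Omega> \<phi> \<omega> w a \<alpha> H b x y B \<xi> \<eta> \<beta>
    by (intro normal_form_subgroup.intro normal_form_subgroup_axioms.intro
        cyclic_regular_action_axioms assms(12,14) assms(13)[unfolded W A] B xy)
  show ?thesis
    using relatively_closed_criterion[OF assms(15)[unfolded W] assms(17)[unfolded assms(16) W] assms(18)]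
    unfolding W .
qed

end
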